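(* Let $\mathcal F$ be a class of finite groups closed under taking subgroups, quotients and direct products. Assume that $\mathcal F$ satisfies the following property: for every prime $p$, if $\mathcal F$ contains a finite nontrivial $p$-group, then it contains all the cyclic finite $p$-groups. Then $\mathcal F(G)$ is closed in $G$ for every profinite group $G$ if and only if $\mathcal F$ is the class of all finite groups.
   Context: For a profinite group $G$, $\mu=\mu_G$ is the normalized Haar measure of $G$, and for $X\subseteq G$, $\langle X\rangle$ denotes the smallest closed subgroup of $G$ containing $X$. A profinite group is a pro-$\mathcal F$ group if it is an inverse limit of groups in $\mathcal F$ (equivalently, all its quotients by open normal subgroups are in $\mathcal F$). For $x\in G$, $\mathcal F_G(x)=\{g\in G : \langle g,x\rangle \text{ is a pro-}\mathcal F\text{ group}\}$, which is a closed (hence measurable) subset of $G$, and $\mathcal F(G)=\{g\in G : \mu(\mathcal F_G(g))>0\}$.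
   Formalization: The class F is additionally assumed to contain a nontrivial group; for the class of trivial groups (or the empty class) F(G) is always closed although F is not the class of all finite groups. *)

theory Defs
  imports "HOL-Analysis.Analysis" "HOL-Algebra.Elementary_Groups"
begin

section \<open>Classes of finite groups\<close>

text \<open>Every finite group is isomorphic to one whose carrier is a set of natural numbers, so an
  (isomorphism-closed) class of finite groups is encoded by its members of type \<open>nat monoid\<close>;
  a group over any other type belongs to the class if it is isomorphic to such a member.\<close>

definition finite_group_class :: "nat monoid set \<Rightarrow> bool" where
  "finite_group_class \<F> \<longleftrightarrow>
     (\<forall>H\<in>\<F>. group H \<and> finite (carrier H)) \<and>
     (\<forall>H\<in>\<F>. \<forall>K::nat monoid. group K \<longrightarrow> H \<cong> K \<longrightarrow> K \<in> \<F>)"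

definition in_class :: "nat monoid set \<Rightarrow> 'b monoid \<Rightarrow> bool" where
  "in_class \<F> K \<longleftrightarrow> group K \<and> finite (carrier K) \<and> (\<exists>H\<in>\<F>. H \<cong> K)"

definition subgroup_closed :: "nat monoid set \<Rightarrow> bool" where
  "subgroup_closed \<F> \<longleftrightarrow>
     (\<forall>H\<in>\<F>. \<forall>S. subgroup S H \<longrightarrow> in_class \<F> (H\<lparr>carrier := S\<rparr>))"

definition quotient_closed :: "nat monoid set \<Rightarrow> bool" where
  "quotient_closed \<F> \<longleftrightarrow> (\<forall>H\<in>\<F>. \<forall>N. N \<lhd> H \<longrightarrow> in_class \<F> (H Mod N))"

definition product_closed :: "nat monoid set \<Rightarrow> bool" where
  "product_closed \<F> \<longleftrightarrow> (\<forall>H\<in>\<F>. \<forall>K\<in>\<F>. in_class \<F> (H \<times>\<times> K))"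

definition contains_nontrivial_p_group :: "nat monoid set \<Rightarrow> nat \<Rightarrow> bool" where
  "contains_nontrivial_p_group \<F> p \<longleftrightarrow> (\<exists>H\<in>\<F>. \<exists>k>0. order H = p ^ k)"

definition contains_all_cyclic_p_groups :: "nat monoid set \<Rightarrow> nat \<Rightarrow> bool" where
  "contains_all_cyclic_p_groups \<F> p \<longleftrightarrow> (\<forall>k. in_class \<F> (integer_mod_group (p ^ k)))"

definition all_finite_groups :: "nat monoid set" where
  "all_finite_groups = {H. group H \<and> finite (carrier H)}"


section \<open>Profinite groups\<close>

definition topological_group :: "'a monoid \<Rightarrow> 'a topology \<Rightarrow> bool" where
  "topological_group G T \<longleftrightarrow>
     group G \<and> topspace T = carrier G \<and>
     continuous_map (prod_topology T T) T (\<lambda>(x, y). x \<otimes>\<^bsub>G\<^esub> y) \<and>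
     continuous_map T T (\<lambda>x. inv\<^bsub>G\<^esub> x)"

definition totally_disconnected_space :: "'a topology \<Rightarrow> bool" where
  "totally_disconnected_space T \<longleftrightarrow>
     (\<forall>S. connectedin T S \<longrightarrow> (\<forall>x\<in>S. \<forall>y\<in>S. x = y))"

definition profinite_group :: "'a monoid \<Rightarrow> 'a topology \<Rightarrow> bool" where
  "profinite_group G T \<longleftrightarrow>
     topological_group G T \<and> compact_space T \<and> Hausdorff_space T \<and>
     totally_disconnected_space T"

definition pro_class_group :: "nat monoid set \<Rightarrow> 'a monoid \<Rightarrow> 'a topology \<Rightarrow> bool" where
  "pro_class_group \<F> G T \<longleftrightarrow>
     profinite_group G T \<and> (\<forall>N. N \<lhd> G \<longrightarrow> openin T N \<longrightarrow> in_class \<F> (G Mod N))"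

definition closed_generate :: "'a monoid \<Rightarrow> 'a topology \<Rightarrow> 'a set \<Rightarrow> 'a set" where
  "closed_generate G T X = \<Inter>{H. subgroup H G \<and> closedin T H \<and> X \<subseteq> H}"


section \<open>Normalized Haar measure\<close>

definition normalized_haar_measure :: "'a monoid \<Rightarrow> 'a topology \<Rightarrow> 'a measure \<Rightarrow> bool" where
  "normalized_haar_measure G T \<mu> \<longleftrightarrow>
     space \<mu> = carrier G \<and>
     sets \<mu> = sigma_sets (carrier G) {U. openin T U} \<and>
     emeasure \<mu> (carrier G) = 1 \<and>
     (\<forall>g\<in>carrier G. \<forall>A\<in>sets \<mu>. emeasure \<mu> (g <#\<^bsub>G\<^esub> A) = emeasure \<mu> A) \<and>
     (\<forall>A\<in>sets \<mu>. emeasure \<mu> A = (INF U\<in>{U. openin T U \<and> A \<subseteq> U}. emeasure \<mu> U)) \<and>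
     (\<forall>U. openin T U \<longrightarrow>
        emeasure \<mu> U = (SUP K\<in>{K. compactin T K \<and> K \<subseteq> U}. emeasure \<mu> K))"


section \<open>The sets attached to a class\<close>

definition class_partners ::
    "nat monoid set \<Rightarrow> 'a monoid \<Rightarrow> 'a topology \<Rightarrow> 'a \<Rightarrow> 'a set" where
  "class_partners \<F> G T x =
     {g \<in> carrier G.
        pro_class_group \<F> (G\<lparr>carrier := closed_generate G T {g, x}\<rparr>)
          (subtopology T (closed_generate G T {g, x}))}"

text \<open>The normalized Haar measure is passed as an argument; it is determined by the topological
  group, by uniqueness of Haar measure.\<close>

definition class_set ::
    "nat monoid set \<Rightarrow> 'a monoid \<Rightarrow> 'a topology \<Rightarrow> 'a measure \<Rightarrow> 'a set" where
  "class_set \<F> G T \<mu> = {g \<in> carrier G. emeasure \<mu> (class_partners \<F> G T g) > 0}"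

end

theory Submission
  imports Defs "HOL-Probability.Infinite_Product_Measure" "HOL-Probability.Probability_Mass_Function"
    "HOL-Algebra.Weak_Morphisms" "HOL-Algebra.Product_Groups" "HOL-Algebra.Sym_Groups"
    "HOL-Algebra.Multiplicative_Group" "HOL-Algebra.Sylow"
begin

text \<open>
  If \<open>\<F>\<close> consists of all finite groups, every closed subgroup of a profinite group \<open>G\<close> is
  pro-\<open>\<F>\<close>, because its quotients by open normal subgroups are finite; so \<open>\<F>(G) = G\<close>
  (\<open>class_partners_all_finite_groups\<close>).

  For the converse the counterexample is a product \<open>G\<close> of finite groups \<open>H n\<close>. A closed subgroup
  of \<open>G\<close> is pro-\<open>\<F>\<close> exactly if its image in each \<open>H n\<close> is in \<open>\<F>\<close>
  (\<open>pro_class_closed_subgroup_iff\<close>). Hence \<open>\<F>\<^sub>G(x)\<close> is the box with sides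
  \<open>P n (x n) = {z \<in> H n. \<langle>z, x n\<rangle> \<in> \<F>}\<close>, and its Haar measure is the product of the proportions
  \<open>card (P n (x n)) / card (H n)\<close>. Suppose that \<open>h n \<in> H n\<close> has the identity among its partners, that
  the proportion of \<open>P n (h n)\<close> stays below a constant \<open>\<delta> < 1\<close>, and that the proportion of
  \<open>P n 1\<close> is at least \<open>1 - 1 / 2 ^ (n + 2)\<close>. Then each of
  \<open>(h 0, \<dots>, h (k - 1), 1, 1, \<dots>)\<close> lies in \<open>\<F>(G)\<close>, but their limit \<open>h\<close> does not
  (\<open>class_set_not_closed\<close>).

  Such factors exist whenever \<open>\<F>\<close> is nontrivial and omits a finite group.

  \<^item> If \<open>\<F>\<close> contains a nontrivial \<open>p\<close>-group for every prime \<open>p\<close>, it contains all finite cyclic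
    groups, so that \<open>P 1\<close> is the whole group for every finite group. An omitted group embeds in a
    symmetric group, which is therefore omitted as well. It is generated by two elements \<open>t\<close> and
    \<open>c\<close>, so \<open>t\<close> is not a partner of \<open>c\<close>; take \<open>h n = c\<close> in this fixed symmetric group
    (\<open>partner_gap_cyclic_closed\<close>).

  \<^item> Otherwise there are a prime \<open>p\<close> for which \<open>\<F>\<close> contains no nontrivial \<open>p\<close>-group and a prime \<open>q\<close>
    for which it contains all cyclic \<open>q\<close>-groups. Let \<open>C\<close> be cyclic of order \<open>m = q ^ (n + 2)\<close>, acting
    on a nonzero elementary abelian \<open>p\<close>-group \<open>V\<close> so that the norm \<open>1 + s + \<dots> + s ^ (m - 1)\<close>
    of every \<open>s \<noteq> 1\<close> in \<open>C\<close> kills \<open>V\<close>. In the semidirect product all elements outside \<open>V\<close> have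
    order dividing \<open>m\<close>, so they are partners of the identity. A subgroup that properly contains the
    complement \<open>C\<close> meets \<open>V\<close> and has an element of order \<open>p\<close>, so the partners of a generator of \<open>C\<close>
    all lie in \<open>C\<close>, and their proportion is at most \<open>1 / card V\<close> (\<open>partner_gap_missing_prime\<close>).

  The entries of the elements of \<open>G\<close> are taken to be real numbers, so that the Haar measure can be
  found among the Borel measures of the Polish space \<open>nat \<Rightarrow> real\<close>. Since that space injects into
  every type with at least as many elements as \<open>nat set\<close>, the whole structure can then be moved there.
\<close>

section \<open>Classes of finite groups\<close>

lemma image_group_inj:
  assumes "group K" "inj_on f (carrier K)"
  shows "group (image_group f K)" "f \<in> iso K (image_group f K)"
proof -
  interpret group K by fact
  have "weak_group_morphism f {\<one>\<^bsub>K\<^esub>} K"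
  proof (rule weak_group_morphismsI)
    show "{\<one>\<^bsub>K\<^esub>} \<lhd> K" by (rule one_is_normal)
  next
    fix a b assume "a \<in> carrier K" "b \<in> carrier K"
    then show "(f a = f b) = (a \<otimes>\<^bsub>K\<^esub> inv\<^bsub>K\<^esub> b \<in> {\<one>\<^bsub>K\<^esub>})"
      using assms(2) by (metis inj_on_eq_iff inv_equality inv_inv inv_closed r_inv singleton_iff)
  qed
  then show "group (image_group f K)" and "f \<in> iso K (image_group f K)"
    using image_group_is_group weak_group_morphism_is_hom assms(2)
    by (auto simp: iso_def bij_betw_def image_group_carrier)
qed

lemma finite_group_copy:
  assumes "group K" "finite (carrier K)" "infinite (UNIV :: 'h set)"
  obtains H :: "'h monoid" and f where "group H" "f \<in> iso K H"
proof -
  obtain A :: "'h set" where "card A = card (carrier K)" "finite A"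
    using infinite_arbitrarily_large[OF assms(3)] by blast
  then obtain f where "bij_betw f (carrier K) A"
    using assms(2) by (metis finite_same_card_bij)
  then show thesis
    using that image_group_inj[OF assms(1), of f] bij_betw_def by blast
qed

lemma subgroup_group:
  assumes "group G" "subgroup S G"
  shows "group (G\<lparr>carrier := S\<rparr>)"
  using assms by (simp add: subgroup.subgroup_is_group)

lemma in_classD:
  assumes "in_class \<F> K"
  shows "group K" "finite (carrier K)"
  using assms by (auto simp: in_class_def)

text \<open>Nonemptiness puts the trivial group into the class, as a quotient of any member.\<close>

locale group_formation =
  fixes \<F> :: "nat monoid set"
  assumes isomorphic_closed: "finite_group_class \<F>"
    and subgroups: "subgroup_closed \<F>"
    and quotients: "quotient_closed \<F>"
    and products: "product_closed \<F>"
    and nonempty: "\<F> \<noteq> {}"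
begin

lemma in_class_iso:
  assumes "in_class \<F> A" "A \<cong> B" "group B"
  shows "in_class \<F> B"
  using assms iso_trans[of _ A B] iso_finite[of A B] unfolding in_class_def by blast

lemma in_class_member:
  assumes "H \<in> \<F>" shows "in_class \<F> H"
  using assms isomorphic_closed iso_refl[of H]
  unfolding in_class_def finite_group_class_def by blast

lemma in_class_subgroup:
  assumes "in_class \<F> A" "subgroup S A"
  shows "in_class \<F> (A\<lparr>carrier := S\<rparr>)"
proof -
  interpret A: group A using assms(1) by (rule in_classD)
  obtain H where H: "H \<in> \<F>" "A \<cong> H"
    using assms(1) isomorphic_closed by (auto simp: in_class_def finite_group_class_def intro: group.iso_sym)
  then obtain f where f: "f \<in> iso A H" by (auto simp: is_iso_def)
  interpret H: group H using H isomorphic_closed by (auto simp: finite_group_class_def)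
  have "subgroup (f ` S) H" using f assms(2)
    by (metis H.is_group subgroup.iso_subgroup A.is_group)
  with subgroups H have "in_class \<F> (H\<lparr>carrier := f ` S\<rparr>)" by (auto simp: subgroup_closed_def)
  moreover have "f \<in> iso (A\<lparr>carrier := S\<rparr>) (H\<lparr>carrier := f ` S\<rparr>)"
    using f subgroup.subset[OF assms(2)]
    by (auto simp: iso_def hom_def bij_betw_def inj_on_def subset_iff)
  ultimately show ?thesis
    using in_class_iso subgroup_group[OF A.is_group assms(2)]
      group.iso_sym[OF subgroup_group[OF A.is_group assms(2)]] is_isoI by blast
qed

lemma in_class_embed:
  assumes "in_class \<F> A" "h \<in> hom B A" "inj_on h (carrier B)" "group B"
  shows "in_class \<F> B"
proof -
  interpret h: group_hom B A h
    using assms in_classD by (auto simp: group_hom_def group_hom_axioms_def)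
  have "h \<in> iso B (A\<lparr>carrier := h ` carrier B\<rparr>)"
    using assms by (auto simp: iso_def hom_def bij_betw_def)
  moreover have "in_class \<F> (A\<lparr>carrier := h ` carrier B\<rparr>)"
    by (rule in_class_subgroup[OF assms(1) h.img_is_subgroup])
  ultimately show ?thesis
    using in_class_iso assms(4) group.iso_sym[OF assms(4)] is_isoI by blast
qed

lemma in_class_epimorphic_image:
  assumes "in_class \<F> A" "h \<in> hom A B" "h ` carrier A = carrier B" "group B"
  shows "in_class \<F> B"
proof -
  obtain H where H: "H \<in> \<F>" "H \<cong> A"
    using assms(1) by (auto simp: in_class_def)
  then obtain f where f: "f \<in> iso H A" by (auto simp: is_iso_def)
  have "h \<circ> f \<in> hom H B" using f assms(2) hom_compose by (auto simp: iso_def)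
  then interpret g: group_hom H B "h \<circ> f"
    using H assms isomorphic_closed by (auto simp: group_hom_def group_hom_axioms_def finite_group_class_def)
  have "(h \<circ> f) ` carrier H = carrier B"
    using f assms(3) unfolding image_comp[symmetric] by (simp add: iso_def bij_betw_def)
  then have "H Mod kernel H B (h \<circ> f) \<cong> B" by (rule g.FactGroup_iso)
  moreover have "in_class \<F> (H Mod kernel H B (h \<circ> f))"
    using quotients H g.normal_kernel by (auto simp: quotient_closed_def)
  ultimately show ?thesis using in_class_iso assms(4) by blast
qed

lemma in_class_DirProd:
  assumes "in_class \<F> A" "in_class \<F> B"
  shows "in_class \<F> (A \<times>\<times> B)"
proof -
  obtain H K where H: "H \<in> \<F>" "H \<cong> A" and K: "K \<in> \<F>" "K \<cong> B"
    using assms by (auto simp: in_class_def)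
  then have "in_class \<F> (H \<times>\<times> K)" using products by (auto simp: product_closed_def)
  then show ?thesis
    using in_class_iso[OF _ group.DirProd_iso_trans[of H A K B] DirProd_group[of A B]]
      H(2) K(2) in_classD(1)[OF in_class_member[OF H(1)]] in_classD(1)[OF assms(1)]
      in_classD(1)[OF assms(2)] by blast
qed

lemma in_class_trivial:
  assumes "group B" "carrier B = {\<one>\<^bsub>B\<^esub>}"
  shows "in_class \<F> B"
proof -
  obtain H where H: "H \<in> \<F>" using nonempty by auto
  interpret B: group B by fact
  have "(\<lambda>_. \<one>\<^bsub>B\<^esub>) \<in> hom H B" by (auto simp: hom_def)
  moreover have "carrier H \<noteq> {}"
    using in_class_member[OF H] in_classD monoid.one_closed group.is_monoid by blast
  then have "(\<lambda>_. \<one>\<^bsub>B\<^esub>) ` carrier H = carrier B"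
    using assms(2) by auto
  ultimately show ?thesis using in_class_epimorphic_image in_class_member H assms(1) by blast
qed

text \<open>The condition on the kernels lets \<open>g\<close> factor through the image of \<open>f\<close>; so \<open>B\<close> is a quotient of a
  subgroup of \<open>A\<close>. This is the form in which closure under subgroups and quotients is applied below
  to quotients of one group by different normal subgroups.\<close>

lemma in_class_same_kernel:
  assumes "in_class \<F> A" "f \<in> hom K A" "g \<in> hom K B" "g ` carrier K = carrier B"
    and "group K" "group B" "kernel K A f \<subseteq> kernel K B g"
  shows "in_class \<F> B"
proof -
  interpret f: group_hom K A f
    using assms in_classD by (auto simp: group_hom_def group_hom_axioms_def)
  interpret g: group_hom K B g
    using assms by (auto simp: group_hom_def group_hom_axioms_def)
  have eq: "g x = g y" if "x \<in> carrier K" "y \<in> carrier K" "f x = f y" for x y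
  proof -
    have "x \<otimes>\<^bsub>K\<^esub> inv\<^bsub>K\<^esub> y \<in> kernel K A f" using that by (simp add: kernel_def)
    then have "x \<otimes>\<^bsub>K\<^esub> inv\<^bsub>K\<^esub> y \<in> kernel K B g" using assms(7) by blast
    then have "g (x \<otimes>\<^bsub>K\<^esub> inv\<^bsub>K\<^esub> y) = \<one>\<^bsub>B\<^esub>" by (simp add: kernel_def)
    then have "g x \<otimes>\<^bsub>B\<^esub> inv\<^bsub>B\<^esub> g y = \<one>\<^bsub>B\<^esub>" using that by simp
    then show ?thesis using that
      by (metis g.H.inv_equality g.H.inv_inv g.hom_closed g.H.inv_closed)
  qed
  define S where "S = f ` carrier K"
  define r where "r = (\<lambda>a. g (inv_into (carrier K) f a))"
  have rf: "r (f x) = g x" if "x \<in> carrier K" for x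
    unfolding r_def using that
    by (intro eq) (auto simp: inv_into_into f_inv_into_f)
  have "r \<in> hom (A\<lparr>carrier := S\<rparr>) B"
    unfolding hom_def S_def
    by (auto simp: rf simp flip: f.hom_mult g.hom_mult)
  moreover have "r ` carrier (A\<lparr>carrier := S\<rparr>) = carrier B"
    using assms(4) unfolding S_def by (simp add: image_image rf cong: image_cong_simp)
  moreover have "in_class \<F> (A\<lparr>carrier := S\<rparr>)"
    unfolding S_def by (rule in_class_subgroup[OF assms(1) f.img_is_subgroup])
  ultimately show ?thesis using in_class_epimorphic_image assms(6) by blast
qed

end

section \<open>Cyclic groups in a class\<close>

context group_formation
begin

text \<open>Taking powers of \<open>x\<close> is an epimorphism from \<open>\<int>/n\<close>, even if \<open>n\<close> is a proper multiple of the
  order of \<open>x\<close>.\<close>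

lemma in_class_cyclic:
  assumes G: "group G" "x \<in> carrier G" "x [^]\<^bsub>G\<^esub> n = \<one>\<^bsub>G\<^esub>" "n > 0"
    and cl: "in_class \<F> (integer_mod_group n)"
  shows "in_class \<F> (G\<lparr>carrier := generate G {x}\<rparr>)"
proof (rule in_class_epimorphic_image[OF cl])
  interpret group G by fact
  have red: "x [^]\<^bsub>G\<^esub> (k mod int n) = x [^]\<^bsub>G\<^esub> k" for k :: int
  proof -
    have "x [^]\<^bsub>G\<^esub> k = x [^]\<^bsub>G\<^esub> (int n * (k div int n) + k mod int n)" by simp
    also have "\<dots> = (x [^]\<^bsub>G\<^esub> int n) [^]\<^bsub>G\<^esub> (k div int n) \<otimes>\<^bsub>G\<^esub> x [^]\<^bsub>G\<^esub> (k mod int n)"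
      using G(2) by (simp only: int_pow_mult int_pow_pow)
    also have "x [^]\<^bsub>G\<^esub> int n = \<one>\<^bsub>G\<^esub>" using G(3) by (simp add: int_pow_int)
    finally show ?thesis using G(2) by simp
  qed
  have gen: "generate G {x} = range (\<lambda>k :: int. x [^]\<^bsub>G\<^esub> k)" using generate_pow[OF G(2)] by auto
  show "(\<lambda>k :: int. x [^]\<^bsub>G\<^esub> k) \<in> hom (integer_mod_group n) (G\<lparr>carrier := generate G {x}\<rparr>)"
    using G(2) unfolding gen by (auto simp: hom_def red int_pow_mult)
  have "x [^]\<^bsub>G\<^esub> k \<in> (\<lambda>k :: int. x [^]\<^bsub>G\<^esub> k) ` {0..<int n}" for k :: int
    using red[of k] G(4) by (auto intro!: image_eqI[of _ _ "k mod int n"])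
  then show "(\<lambda>k :: int. x [^]\<^bsub>G\<^esub> k) ` carrier (integer_mod_group n) = carrier (G\<lparr>carrier := generate G {x}\<rparr>)"
    using G(4) unfolding gen by (auto simp: carrier_integer_mod_group)
  show "group (G\<lparr>carrier := generate G {x}\<rparr>)"
    using G by (intro subgroup_group generate_is_subgroup) auto
qed

text \<open>By the Chinese remainder theorem, reduction modulo \<open>a\<close> and \<open>b\<close> embeds \<open>\<int>/ab\<close> in the product.\<close>

lemma in_class_cyclic_coprime:
  assumes cl: "in_class \<F> (integer_mod_group a)" "in_class \<F> (integer_mod_group b)"
    and ab: "coprime a b" "a > 0" "b > 0"
  shows "in_class \<F> (integer_mod_group (a * b))"
proof (rule in_class_embed[OF in_class_DirProd[OF cl]])
  let ?f = "\<lambda>x :: int. (x mod int a, x mod int b)"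
  show "?f \<in> hom (integer_mod_group (a * b)) (integer_mod_group a \<times>\<times> integer_mod_group b)"
    using ab by (auto simp: hom_def carrier_integer_mod_group mod_simps mod_mod_cancel)
  show "inj_on ?f (carrier (integer_mod_group (a * b)))"
  proof (rule inj_onI)
    fix x y assume xy: "x \<in> carrier (integer_mod_group (a * b))" "y \<in> carrier (integer_mod_group (a * b))" "?f x = ?f y"
    then have "int a dvd x - y" "int b dvd x - y" by (auto simp: mod_eq_dvd_iff)
    then have "int a * int b dvd x - y" using ab(1) by (intro divides_mult) auto
    then have "x mod (int a * int b) = y mod (int a * int b)" by (simp add: mod_eq_dvd_iff)
    with xy ab show "x = y" by (simp add: carrier_integer_mod_group)
  qed
qed simp

lemma in_class_all_cyclic:
  assumes pp: "\<And>p. Factorial_Ring.prime p \<Longrightarrow> contains_all_cyclic_p_groups \<F> p" and n: "n > 0"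
  shows "in_class \<F> (integer_mod_group n)"
  using n
proof (induction n rule: less_induct)
  case (less n)
  show ?case
  proof (cases "n = 1")
    case True
    then show ?thesis by (intro in_class_trivial) (auto simp: carrier_integer_mod_group)
  next
    case False
    then obtain p where p: "Factorial_Ring.prime p" "p dvd n" using prime_factor_nat by blast
    define k where "k = multiplicity p n"
    obtain r where r: "n = p ^ k * r" "\<not> p dvd r"
      using multiplicity_decompose'[of n p] less.prems prime_gt_1_nat[OF p(1)] unfolding k_def by auto
    have "k > 0" unfolding k_def using p less.prems by (simp add: prime_multiplicity_gt_zero_iff)
    then have "p ^ k > 1" by (rule one_less_power[OF prime_gt_1_nat[OF p(1)]])
    moreover have "r > 0" using less.prems r(1) by (cases r) auto
    ultimately have "r < n" using r(1) by simp
    then have "in_class \<F> (integer_mod_group r)" using less.IH \<open>r > 0\<close> by blast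
    moreover have "in_class \<F> (integer_mod_group (p ^ k))"
      using pp[OF p(1)] by (simp add: contains_all_cyclic_p_groups_def)
    moreover have "coprime (p ^ k) r" using p(1) r(2) by (simp add: prime_imp_coprime)
    ultimately show ?thesis
      using in_class_cyclic_coprime \<open>r > 0\<close> prime_gt_0_nat[OF p(1)] unfolding r(1) by simp
  qed
qed

end

section \<open>Closed subgroups of profinite groups\<close>

lemma profinite_groupD:
  assumes "profinite_group G T"
  shows "group G" "topspace T = carrier G" "compact_space T" "Hausdorff_space T"
    "continuous_map (prod_topology T T) T (\<lambda>(x, y). x \<otimes>\<^bsub>G\<^esub> y)"
    "continuous_map T T (\<lambda>x. inv\<^bsub>G\<^esub> x)" "totally_disconnected_space T"
  using assms by (auto simp: profinite_group_def topological_group_def)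

lemma closed_subgroup_profinite:
  assumes G: "profinite_group G T" and K: "subgroup K G" "closedin T K"
  shows "profinite_group (G\<lparr>carrier := K\<rparr>) (subtopology T K)"
proof -
  note * = profinite_groupD[OF G]
  interpret group G by (rule *)
  have KG: "K \<subseteq> carrier G" using K(1) by (rule subgroup.subset)
  have "continuous_map (prod_topology (subtopology T K) (subtopology T K)) (subtopology T K)
      (\<lambda>(x, y). x \<otimes>\<^bsub>G\<^esub> y)"
    using *(5) K(1) unfolding subtopology_Times[symmetric]
    by (intro continuous_map_into_subtopology continuous_map_from_subtopology)
      (auto simp: subgroup.m_closed)
  moreover have "continuous_map (subtopology T K) (subtopology T K) (\<lambda>x. inv\<^bsub>G\<^esub> x)"
    using *(6) K(1)
    by (intro continuous_map_into_subtopology continuous_map_from_subtopology)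
      (auto simp: subgroup.m_inv_closed)
  then have "continuous_map (subtopology T K) (subtopology T K) (\<lambda>x. inv\<^bsub>G\<lparr>carrier := K\<rparr>\<^esub> x)"
    by (rule continuous_map_eq) (simp add: K m_inv_consistent)
  moreover have "topspace (subtopology T K) = K" using KG *(2) by auto
  moreover have "totally_disconnected_space (subtopology T K)"
    using *(7) by (auto simp: totally_disconnected_space_def connectedin_subtopology)
  moreover have "compact_space (subtopology T K)"
    using *(3) K(2) closedin_compact_space compact_space_subtopology by blast
  ultimately show ?thesis
    using *(4) subgroup_group[OF is_group K(1)]
    by (auto simp: profinite_group_def topological_group_def Hausdorff_space_subtopology)
qed

text \<open>The cosets form an open cover by disjoint nonempty sets, so a finite subcover contains all of them.\<close>

lemma finite_quotient_by_open_normal: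
  assumes G: "profinite_group G T" and N: "N \<lhd> G" "openin T N"
  shows "finite (carrier (G Mod N))"
proof -
  note * = profinite_groupD[OF G]
  interpret N: normal N G by fact
  have sub: "subgroup N G" by (rule N.subgroup_axioms)
  have "openin T (N #>\<^bsub>G\<^esub> a)" if a: "a \<in> carrier G" for a
  proof -
    have "continuous_map T T (\<lambda>x. x \<otimes>\<^bsub>G\<^esub> inv\<^bsub>G\<^esub> a)"
      using continuous_map_compose[OF _ *(5), of T "\<lambda>x. (x, inv\<^bsub>G\<^esub> a)"] a
      by (simp add: continuous_map_pairwise o_def *(2))
    then have "openin T {x \<in> topspace T. x \<otimes>\<^bsub>G\<^esub> inv\<^bsub>G\<^esub> a \<in> N}"
      using N(2) openin_continuous_map_preimage by blast
    moreover have "{x \<in> topspace T. x \<otimes>\<^bsub>G\<^esub> inv\<^bsub>G\<^esub> a \<in> N} = N #>\<^bsub>G\<^esub> a"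
      unfolding r_coset_def *(2)
      using a N.subset by (force simp: N.m_assoc)
    ultimately show ?thesis by simp
  qed
  then have "\<forall>U\<in>rcosets\<^bsub>G\<^esub> N. openin T U" by (auto simp: RCOSETS_def)
  moreover have "\<Union>(rcosets\<^bsub>G\<^esub> N) = topspace T" using N.rcosets_part_G[OF sub] *(2) by simp
  ultimately obtain F where F: "finite F" "F \<subseteq> rcosets\<^bsub>G\<^esub> N" "\<Union>F = topspace T"
    using *(3)[unfolded compact_space, rule_format, of "rcosets\<^bsub>G\<^esub> N"] by auto
  have "rcosets\<^bsub>G\<^esub> N \<subseteq> F"
  proof
    fix C assume C: "C \<in> rcosets\<^bsub>G\<^esub> N"
    then obtain a where a: "a \<in> C" using N.rcosets_non_empty[OF C] by blast
    have "a \<in> \<Union>(rcosets\<^bsub>G\<^esub> N)" using a C by (rule UnionI[rotated])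
    then have "a \<in> carrier G" unfolding N.rcosets_part_G[OF sub] .
    then obtain D where D: "D \<in> F" "a \<in> D" using F(3) *(2) by auto
    then have "\<not> disjnt C D" "D \<in> rcosets\<^bsub>G\<^esub> N" using a F(2) by (auto simp: disjnt_iff)
    then have "C = D" using pairwiseD[OF N.rcos_disjoint[OF sub] C] by blast
    then show "C \<in> F" using D by simp
  qed
  then show ?thesis using F(1) finite_subset by (auto simp: FactGroup_def)
qed

lemma closed_generate_subset:
  "X \<subseteq> carrier G \<Longrightarrow> X \<subseteq> closed_generate G T X"
  by (auto simp: closed_generate_def)

lemma closed_generate_least:
  "subgroup H G \<Longrightarrow> closedin T H \<Longrightarrow> X \<subseteq> H \<Longrightarrow> closed_generate G T X \<subseteq> H"
  by (auto simp: closed_generate_def)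

lemma closed_generate_closed_subgroup:
  assumes "profinite_group G T" "X \<subseteq> carrier G"
  shows "subgroup (closed_generate G T X) G" "closedin T (closed_generate G T X)"
proof -
  note * = profinite_groupD[OF assms(1)]
  interpret group G by (rule *)
  have "carrier G \<in> {H. subgroup H G \<and> closedin T H \<and> X \<subseteq> H}"
    using assms(2) subgroup_self *(2) closedin_topspace[of T] by auto
  then show "subgroup (closed_generate G T X) G" "closedin T (closed_generate G T X)"
    unfolding closed_generate_def by (auto intro!: subgroups_Inter closedin_Inter)
qed

text \<open>The set \<open>class_partners\<close> of a finite discrete group, stated without its topology.\<close>

definition finite_partners :: "nat monoid set \<Rightarrow> 'b monoid \<Rightarrow> 'b \<Rightarrow> 'b set" where
  "finite_partners \<F> H h =
     {g \<in> carrier H. in_class \<F> (H\<lparr>carrier := generate H {g, h}\<rparr>)}"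

text \<open>The coordinate projections of a product of finite groups have these properties. Working with
  them abstractly makes the results independent of how the elements of \<open>G\<close> are represented.\<close>

locale separated_profinite =
  fixes G :: "'a monoid" and T :: "'a topology" and H :: "nat \<Rightarrow> 'b monoid" and \<pi> :: "nat \<Rightarrow> 'a \<Rightarrow> 'b"
  assumes profinite: "profinite_group G T"
    and H: "\<And>n. group (H n)"
    and hom: "\<And>n. \<pi> n \<in> hom G (H n)"
    and continuous: "\<And>n. continuous_map T (discrete_topology (carrier (H n))) (\<pi> n)"
    and separating: "\<And>x. x \<in> carrier G \<Longrightarrow> (\<And>n. \<pi> n x = \<one>\<^bsub>H n\<^esub>) \<Longrightarrow> x = \<one>\<^bsub>G\<^esub>"
begin

sublocale G: group G using profinite by (rule profinite_groupD)
sublocale H: group "H n" for n by (rule H)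
sublocale \<pi>: group_hom G "H n" "\<pi> n" for n
  using hom by unfold_locales

lemma clopen_preimage:
  shows "openin T {x \<in> carrier G. \<pi> n x \<in> A}" "closedin T {x \<in> carrier G. \<pi> n x \<in> A}"
proof -
  have eq: "{x \<in> carrier G. \<pi> n x \<in> A} = {x \<in> topspace T. \<pi> n x \<in> A \<inter> carrier (H n)}"
    using profinite_groupD(2)[OF profinite] by auto
  show "openin T {x \<in> carrier G. \<pi> n x \<in> A}" "closedin T {x \<in> carrier G. \<pi> n x \<in> A}"
    unfolding eq
    by (rule openin_continuous_map_preimage[OF continuous] closedin_continuous_map_preimage[OF continuous],
        simp)+
qed

text \<open>The preimage of a subgroup of \<open>H n\<close> is a closed subgroup because \<open>H n\<close> is discrete.\<close>

lemma image_closed_generate: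
  assumes "X \<subseteq> carrier G"
  shows "\<pi> n ` closed_generate G T X = generate (H n) (\<pi> n ` X)"
proof
  note K = closed_generate_closed_subgroup[OF profinite assms]
  have sub: "\<pi> n ` X \<subseteq> carrier (H n)" using assms by auto
  define S where "S = {x \<in> carrier G. \<pi> n x \<in> generate (H n) (\<pi> n ` X)}"
  have "\<one>\<^bsub>G\<^esub> \<in> S" by (simp add: S_def generate.one)
  then have "subgroup S G"
    using H.generate_is_subgroup[OF sub]
    by (intro G.subgroupI) (auto simp: S_def subgroup.m_closed subgroup.m_inv_closed)
  moreover have "closedin T S" unfolding S_def by (rule clopen_preimage)
  moreover have "X \<subseteq> S" using assms unfolding S_def by (auto intro: generate.incl)
  ultimately have "closed_generate G T X \<subseteq> S" by (rule closed_generate_least)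
  then show "\<pi> n ` closed_generate G T X \<subseteq> generate (H n) (\<pi> n ` X)" by (auto simp: S_def)
  show "generate (H n) (\<pi> n ` X) \<subseteq> \<pi> n ` closed_generate G T X"
    using closed_generate_subset[OF assms] \<pi>.subgroup_img_is_subgroup[OF K(1)]
    by (intro H.generate_subgroup_incl) auto
qed

definition kernels :: "'a set \<Rightarrow> nat \<Rightarrow> 'a set" where
  "kernels K m = {x \<in> K. \<forall>n<m. \<pi> n x = \<one>\<^bsub>H n\<^esub>}"

lemma kernels_normal:
  assumes "subgroup K G"
  shows "kernels K m \<lhd> G\<lparr>carrier := K\<rparr>"
proof -
  interpret K: group "G\<lparr>carrier := K\<rparr>" using subgroup_group[OF G.is_group assms] .
  note KG = subgroup.mem_carrier[OF assms]
  have "subgroup (kernels K m) (G\<lparr>carrier := K\<rparr>)"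
    using assms KG
    by (intro K.subgroupI) (auto simp: kernels_def subgroup.m_closed subgroup.m_inv_closed
        subgroup.one_closed intro!: exI[of _ "\<one>\<^bsub>G\<^esub>"])
  then show ?thesis
    unfolding K.normal_inv_iff
    using assms KG
    by (auto simp: kernels_def subgroup.m_closed subgroup.m_inv_closed)
qed

lemma closedin_kernels:
  assumes "subgroup K G" "closedin T K"
  shows "closedin T (kernels K m)"
proof (induction m)
  case 0
  then show ?case using assms(2) by (simp add: kernels_def)
next
  case (Suc m)
  have "kernels K (Suc m) = kernels K m \<inter> {x \<in> carrier G. \<pi> m x \<in> {\<one>\<^bsub>H m\<^esub>}}"
    using subgroup.mem_carrier[OF assms(1)] by (auto simp: kernels_def less_Suc_eq)
  then show ?case using Suc.IH clopen_preimage(2)[of m "{\<one>\<^bsub>H m\<^esub>}"] by auto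
qed

text \<open>The kernels shrink to the identity, which lies in the open set \<open>N\<close>; by compactness one of them is
  already contained in \<open>N\<close>.\<close>

lemma open_subgroup_contains_kernels:
  assumes K: "subgroup K G" "closedin T K"
    and N: "subgroup N (G\<lparr>carrier := K\<rparr>)" "openin (subtopology T K) N"
  obtains m where "kernels K m \<subseteq> N"
proof (rule ccontr)
  assume *: "\<not> thesis"
  obtain U where U: "openin T U" "N = U \<inter> K" using N(2) by (auto simp: openin_subtopology)
  have "closedin T (kernels K m - U)" for m
    using U(1) closedin_kernels[OF K] by (rule closedin_diff[rotated])
  moreover have "kernels K m - U \<noteq> {}" for m
  proof
    assume "kernels K m - U = {}"
    then have "kernels K m \<subseteq> N" using U(2) by (auto simp: kernels_def)
    with * that show False by blast
  qed
  moreover have "decseq (\<lambda>m. kernels K m - U)"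
    by (auto simp: decseq_def kernels_def)
  ultimately have "(\<Inter>m. kernels K m - U) \<noteq> {}"
    using profinite_groupD(3)[OF profinite] by (intro compact_space_imp_nest)
  then obtain x where x: "\<And>m. x \<in> kernels K m - U" by auto
  have "\<pi> n x = \<one>\<^bsub>H n\<^esub>" for n using x[of "Suc n"] by (auto simp: kernels_def)
  moreover have "x \<in> K" using x[of 0] by (auto simp: kernels_def)
  ultimately have "x = \<one>\<^bsub>G\<^esub>" using separating subgroup.mem_carrier[OF K(1)] by blast
  moreover have "\<one>\<^bsub>G\<^esub> \<in> N" using subgroup.one_closed[OF N(1)] by simp
  ultimately show False using x[of 0] U(2) by auto
qed

end

lemma coset_kernel:
  assumes "N \<lhd> K" shows "kernel K (K Mod N) (\<lambda>x. N #>\<^bsub>K\<^esub> x) = N"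
proof -
  interpret normal N K by fact
  show ?thesis
    using coset_join1[OF _ _ subgroup_axioms] coset_join2[OF _ subgroup_axioms] subset
    by (auto simp: kernel_def FactGroup_def)
qed

lemma coset_epi:
  assumes "N \<lhd> K"
  shows "(\<lambda>x. N #>\<^bsub>K\<^esub> x) \<in> hom K (K Mod N)" "(\<lambda>x. N #>\<^bsub>K\<^esub> x) ` carrier K = carrier (K Mod N)"
proof -
  interpret normal N K by fact
  show "(\<lambda>x. N #>\<^bsub>K\<^esub> x) \<in> hom K (K Mod N)" by (rule r_coset_hom_Mod)
  show "(\<lambda>x. N #>\<^bsub>K\<^esub> x) ` carrier K = carrier (K Mod N)"
    by (auto simp: FactGroup_def RCOSETS_def)
qed

locale separated_profinite_formation = separated_profinite G T H \<pi> + group_formation \<F>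
  for G :: "'a monoid" and T H and \<pi> :: "nat \<Rightarrow> 'a \<Rightarrow> 'b" and \<F>
begin

text \<open>In the induction step, the quotient by \<open>kernels K (Suc m)\<close> embeds in the product of the quotient
  by \<open>kernels K m\<close> and the image under \<open>\<pi> m\<close>.\<close>

lemma in_class_Mod_kernels:
  assumes K: "subgroup K G" and cl: "\<And>n. in_class \<F> (H n\<lparr>carrier := \<pi> n ` K\<rparr>)"
  shows "in_class \<F> (G\<lparr>carrier := K\<rparr> Mod kernels K m)"
proof (induction m)
  case 0
  have eq: "kernels K 0 = carrier (G\<lparr>carrier := K\<rparr>)" by (simp add: kernels_def)
  interpret K: group "G\<lparr>carrier := K\<rparr>" using subgroup_group[OF G.is_group K] .
  interpret N: normal "kernels K 0" "G\<lparr>carrier := K\<rparr>" by (rule kernels_normal[OF K])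
  have "carrier (G\<lparr>carrier := K\<rparr> Mod carrier (G\<lparr>carrier := K\<rparr>)) =
      {\<one>\<^bsub>G\<lparr>carrier := K\<rparr> Mod carrier (G\<lparr>carrier := K\<rparr>)\<^esub>}"
    using K.coset_join2[OF _ K.subgroup_self] K.one_closed unfolding FactGroup_def RCOSETS_def
    by auto
  then show ?case unfolding eq[symmetric] by (rule in_class_trivial[OF N.factorgroup_is_group])
next
  case (Suc m)
  let ?K = "G\<lparr>carrier := K\<rparr>"
  interpret K: group ?K using subgroup_group[OF G.is_group K] .
  interpret N: normal "kernels K m" ?K by (rule kernels_normal[OF K])
  interpret N': normal "kernels K (Suc m)" ?K by (rule kernels_normal[OF K])
  note e = coset_epi[OF kernels_normal[OF K]]
  let ?A = "(?K Mod kernels K m) \<times>\<times> (H m\<lparr>carrier := \<pi> m ` K\<rparr>)"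
  have "(\<lambda>x. (kernels K m #>\<^bsub>?K\<^esub> x, \<pi> m x)) \<in> hom ?K ?A"
    unfolding hom_paired using e(1) subgroup.mem_carrier[OF K] by (auto simp: hom_def)
  moreover have "kernel ?K ?A (\<lambda>x. (kernels K m #>\<^bsub>?K\<^esub> x, \<pi> m x)) \<subseteq>
      kernel ?K (?K Mod kernels K (Suc m)) (\<lambda>x. kernels K (Suc m) #>\<^bsub>?K\<^esub> x)"
  proof
    fix x assume "x \<in> kernel ?K ?A (\<lambda>x. (kernels K m #>\<^bsub>?K\<^esub> x, \<pi> m x))"
    then have "x \<in> kernel ?K (?K Mod kernels K m) (\<lambda>x. kernels K m #>\<^bsub>?K\<^esub> x)" "\<pi> m x = \<one>\<^bsub>H m\<^esub>"
      by (auto simp: kernel_def)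
    then show "x \<in> kernel ?K (?K Mod kernels K (Suc m)) (\<lambda>x. kernels K (Suc m) #>\<^bsub>?K\<^esub> x)"
      unfolding coset_kernel[OF kernels_normal[OF K]] by (auto simp: kernels_def less_Suc_eq)
  qed
  ultimately show ?case
    using in_class_same_kernel[OF in_class_DirProd[OF Suc.IH cl[of m]] _ e(1) e(2)]
      K.is_group N'.factorgroup_is_group by blast
qed

text \<open>The image under \<open>\<pi> n\<close> is the quotient by an open normal subgroup. Conversely, an open normal
  subgroup contains some \<open>kernels K m\<close>, so its quotient is a quotient of one known to be in
  the class.\<close>

lemma pro_class_closed_subgroup_iff:
  assumes K: "subgroup K G" "closedin T K"
  shows "pro_class_group \<F> (G\<lparr>carrier := K\<rparr>) (subtopology T K) \<longleftrightarrow>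
    (\<forall>n. in_class \<F> (H n\<lparr>carrier := \<pi> n ` K\<rparr>))"
proof (intro iffI allI)
  fix n
  let ?K = "G\<lparr>carrier := K\<rparr>" and ?H = "H n\<lparr>carrier := \<pi> n ` K\<rparr>"
  assume pro: "pro_class_group \<F> ?K (subtopology T K)"
  interpret hom: group_hom ?K ?H "\<pi> n"
    using subgroup_group[OF G.is_group K(1)] subgroup_group[OF H \<pi>.subgroup_img_is_subgroup[OF K(1)]]
      subgroup.mem_carrier[OF K(1)]
    by (auto simp: group_hom_def group_hom_axioms_def hom_def)
  have "kernel ?K ?H (\<pi> n) = K \<inter> {x \<in> carrier G. \<pi> n x \<in> {\<one>\<^bsub>H n\<^esub>}}"
    using subgroup.mem_carrier[OF K(1)] by (auto simp: kernel_def)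
  then have "openin (subtopology T K) (kernel ?K ?H (\<pi> n))"
    using clopen_preimage(1)[of n "{\<one>\<^bsub>H n\<^esub>}"] by (auto simp: openin_subtopology)
  then have "in_class \<F> (?K Mod kernel ?K ?H (\<pi> n))"
    using pro hom.normal_kernel by (simp add: pro_class_group_def)
  moreover have "?K Mod kernel ?K ?H (\<pi> n) \<cong> ?H" by (rule hom.FactGroup_iso) simp
  ultimately show "in_class \<F> ?H" using in_class_iso hom.H.is_group by blast
next
  let ?K = "G\<lparr>carrier := K\<rparr>"
  assume cl: "\<forall>n. in_class \<F> (H n\<lparr>carrier := \<pi> n ` K\<rparr>)"
  have "in_class \<F> (?K Mod N)" if N: "N \<lhd> ?K" "openin (subtopology T K) N" for N
  proof -
    interpret N: normal N ?K by fact
    obtain m where m: "kernels K m \<subseteq> N"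
      using open_subgroup_contains_kernels[OF K N.subgroup_axioms N(2)] .
    note M = kernels_normal[OF K(1), of m]
    have "in_class \<F> (?K Mod kernels K m)" using in_class_Mod_kernels[OF K(1)] cl by blast
    then show ?thesis
      using in_class_same_kernel[OF _ coset_epi(1)[OF M] coset_epi[OF N(1)]]
        coset_kernel[OF N(1)] coset_kernel[OF M] m N.is_group N.factorgroup_is_group by simp
  qed
  then show "pro_class_group \<F> ?K (subtopology T K)"
    using closed_subgroup_profinite[OF profinite K] by (simp add: pro_class_group_def)
qed

lemma class_partners_eq:
  assumes "x \<in> carrier G"
  shows "class_partners \<F> G T x = {g \<in> carrier G. \<forall>n. \<pi> n g \<in> finite_partners \<F> (H n) (\<pi> n x)}"
proof -
  have "pro_class_group \<F> (G\<lparr>carrier := closed_generate G T {g, x}\<rparr>)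
          (subtopology T (closed_generate G T {g, x})) \<longleftrightarrow>
       (\<forall>n. in_class \<F> (H n\<lparr>carrier := generate (H n) {\<pi> n g, \<pi> n x}\<rparr>))" if "g \<in> carrier G" for g
  proof -
    have "{g, x} \<subseteq> carrier G" using assms that by auto
    note K = closed_generate_closed_subgroup[OF profinite this] image_closed_generate[OF this]
    show ?thesis unfolding pro_class_closed_subgroup_iff[OF K(1,2)] K(3) by simp
  qed
  then show ?thesis unfolding class_partners_def finite_partners_def by auto
qed

end

lemma in_class_all_finite_groups:
  assumes "group K" "finite (carrier K)"
  shows "in_class all_finite_groups K"
proof -
  obtain H :: "nat monoid" and f where H: "group H" "f \<in> iso K H"
    using finite_group_copy[OF assms] by auto
  from H(2) have "K \<cong> H" by (rule is_isoI)
  then show ?thesis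
    using H(1) assms group.iso_sym[OF assms(1)] iso_finite[OF \<open>K \<cong> H\<close>]
    by (auto simp: in_class_def all_finite_groups_def)
qed

lemma class_partners_all_finite_groups:
  assumes "profinite_group G T" "x \<in> carrier G"
  shows "class_partners all_finite_groups G T x = carrier G"
proof -
  have "pro_class_group all_finite_groups (G\<lparr>carrier := K\<rparr>) (subtopology T K)"
    if "K = closed_generate G T {g, x}" "g \<in> carrier G" for g K
  proof -
    have "{g, x} \<subseteq> carrier G" using assms that by auto
    from closed_generate_closed_subgroup[OF assms(1) this]
    have pro: "profinite_group (G\<lparr>carrier := K\<rparr>) (subtopology T K)"
      using closed_subgroup_profinite[OF assms(1)] that(1) by blast
    then show ?thesis
      unfolding pro_class_group_def
      using finite_quotient_by_open_normal[OF pro]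
      by (auto intro!: in_class_all_finite_groups normal.factorgroup_is_group)
  qed
  then show ?thesis by (auto simp: class_partners_def)
qed

section \<open>Partners in finite groups\<close>

lemma finite_partners_iso:
  assumes form: "group_formation \<F>" and f: "f \<in> iso K H" and grp: "group K" "group H" and h: "h \<in> carrier K"
  shows "finite_partners \<F> H (f h) = f ` finite_partners \<F> K h"
proof -
  interpret group_formation \<F> by (rule form)
  interpret f: group_hom K H f
    using f grp by (auto simp: group_hom_def group_hom_axioms_def iso_def)
  have img: "f ` carrier K = carrier H" and inj: "inj_on f (carrier K)"
    using f by (auto simp: iso_def bij_betw_def)
  have "in_class \<F> (H\<lparr>carrier := generate H {f g, f h}\<rparr>) \<longleftrightarrow>
      in_class \<F> (K\<lparr>carrier := generate K {g, h}\<rparr>)" if g: "g \<in> carrier K" for g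
  proof -
    let ?A = "K\<lparr>carrier := generate K {g, h}\<rparr>" and ?B = "H\<lparr>carrier := generate H {f g, f h}\<rparr>"
    have sub: "subgroup (generate K {g, h}) K" "subgroup (generate H {f g, f h}) H"
      using g h by (auto intro!: f.G.generate_is_subgroup f.H.generate_is_subgroup)
    have gen: "generate H {f g, f h} = f ` generate K {g, h}"
      using f.generate_img[of "{g, h}"] g h by simp
    have "f \<in> iso ?A ?B"
      using sub(1) inj gen subgroup.mem_carrier[OF sub(1)]
      by (auto simp: iso_def hom_def bij_betw_def inj_on_def)
    then have "?A \<cong> ?B" "?B \<cong> ?A"
      using is_isoI group.iso_sym[OF subgroup_group[OF grp(1) sub(1)]] by blast+
    then show ?thesis
      using in_class_iso[of ?A ?B] in_class_iso[of ?B ?A] subgroup_group[OF grp(1) sub(1)] subgroup_group[OF grp(2) sub(2)] by blast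
  qed
  then show ?thesis
    unfolding finite_partners_def img[symmetric] by auto
qed

lemma (in group) generate_insert_one:
  assumes "h \<in> carrier G"
  shows "generate G {\<one>, h} = generate G {h}"
proof
  show "generate G {\<one>, h} \<subseteq> generate G {h}"
    using assms by (intro generate_subgroup_incl generate_is_subgroup) (auto intro: generate.one generate.incl)
  show "generate G {h} \<subseteq> generate G {\<one>, h}" by (rule mono_generate) simp
qed

context group_formation
begin

lemma one_in_finite_partners_iff:
  assumes "group K" "h \<in> carrier K"
  shows "\<one>\<^bsub>K\<^esub> \<in> finite_partners \<F> K h \<longleftrightarrow> in_class \<F> (K\<lparr>carrier := generate K {h}\<rparr>)"
    "h \<in> finite_partners \<F> K \<one>\<^bsub>K\<^esub> \<longleftrightarrow> in_class \<F> (K\<lparr>carrier := generate K {h}\<rparr>)"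
proof -
  interpret group K by fact
  have "generate K {h, \<one>\<^bsub>K\<^esub>} = generate K {h}"
    using generate_insert_one[OF assms(2)] by (simp add: insert_commute)
  then show "\<one>\<^bsub>K\<^esub> \<in> finite_partners \<F> K h \<longleftrightarrow> in_class \<F> (K\<lparr>carrier := generate K {h}\<rparr>)"
    "h \<in> finite_partners \<F> K \<one>\<^bsub>K\<^esub> \<longleftrightarrow> in_class \<F> (K\<lparr>carrier := generate K {h}\<rparr>)"
    using generate_insert_one[OF assms(2)] assms(2) by (auto simp: finite_partners_def)
qed

end

text \<open>The requirements on a factor of the product: \<open>h\<close> has the identity as a partner, but only a
  proportion \<open>\<delta>\<close> of all elements, whereas all but a proportion \<open>\<epsilon>\<close> are partners of the
  identity. Along the sequence of factors \<open>\<epsilon>\<close> is summable and \<open>\<delta> < 1\<close> is constant.\<close>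

definition partner_gap :: "nat monoid set \<Rightarrow> 'b monoid \<Rightarrow> 'b \<Rightarrow> real \<Rightarrow> real \<Rightarrow> bool" where
  "partner_gap \<F> K h \<epsilon> \<delta> \<longleftrightarrow> group K \<and> finite (carrier K) \<and> h \<in> carrier K \<and>
     \<one>\<^bsub>K\<^esub> \<in> finite_partners \<F> K h \<and>
     (1 - \<epsilon>) * real (card (carrier K)) \<le> card (finite_partners \<F> K \<one>\<^bsub>K\<^esub>) \<and>
     real (card (finite_partners \<F> K h)) \<le> \<delta> * real (card (carrier K))"

lemma partner_gap_copy:
  assumes "group_formation \<F>" "partner_gap \<F> K h \<epsilon> \<delta>" "infinite (UNIV :: 'h set)"
  shows "\<exists>(K' :: 'h monoid) h'. partner_gap \<F> K' h' \<epsilon> \<delta>"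
proof -
  have K: "group K" "finite (carrier K)" "h \<in> carrier K" using assms(2) by (auto simp: partner_gap_def)
  obtain K' :: "'h monoid" and f where K': "group K'" "f \<in> iso K K'"
    using finite_group_copy[OF K(1,2) assms(3)] .
  interpret f: group_hom K K' f
    using K K' by (auto simp: group_hom_def group_hom_axioms_def iso_def)
  have inj: "inj_on f (carrier K)" "carrier K' = f ` carrier K" using K'(2) by (auto simp: iso_def bij_betw_def)
  note eq = finite_partners_iso[OF assms(1) K'(2) K(1) K'(1)]
  have card: "card (f ` finite_partners \<F> K x) = card (finite_partners \<F> K x)" for x
    by (intro card_image inj_on_subset[OF inj(1)]) (auto simp: finite_partners_def)
  have "finite_partners \<F> K' \<one>\<^bsub>K'\<^esub> = f ` finite_partners \<F> K \<one>\<^bsub>K\<^esub>"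
    using eq[of "\<one>\<^bsub>K\<^esub>"] by simp
  then have "partner_gap \<F> K' (f h) \<epsilon> \<delta>"
    using assms(2) K'(1) K(3) card_image[OF inj(1)]
    unfolding partner_gap_def eq[OF K(3)] inj(2) by (auto simp: card inj(2) intro: image_eqI[of _ f, OF f.hom_one[symmetric]])
  then show ?thesis by blast
qed

section \<open>Transport of profinite groups along injections\<close>

text \<open>Multiplication, topology and measure are moved along \<open>f\<close>, which becomes an isomorphism, a
  homeomorphism and a measure preserving map onto the new group.\<close>

locale group_transport = group G for G :: "'b monoid" (structure) +
  fixes T :: "'b topology" and \<mu> :: "'b measure" and f :: "'b \<Rightarrow> 'a"
  assumes profinite: "profinite_group G T" and haar: "normalized_haar_measure G T \<mu>"
    and inj: "inj_on f (carrier G)"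
begin

definition G' where "G' = image_group f G"
definition T' where "T' = pullback_topology (f ` carrier G) (inv_into (carrier G) f) T"
definition \<mu>' where "\<mu>' = distr \<mu> (sigma (f ` carrier G) {U. openin T' U}) f"

lemma iso: "f \<in> iso G G'" and group_G': "group G'"
  unfolding G'_def using image_group_inj[OF is_group inj] by auto

lemma carrier_G': "carrier G' = f ` carrier G"
  by (simp add: G'_def image_group_carrier)

lemma topspace_T: "topspace T = carrier G"
  using profinite by (simp add: profinite_group_def topological_group_def)

lemma vimage_inverse:
  assumes "V \<subseteq> carrier G"
  shows "inv_into (carrier G) f -` V \<inter> f ` carrier G = f ` V"
proof (intro equalityI subsetI)
  fix x assume "x \<in> inv_into (carrier G) f -` V \<inter> f ` carrier G"
  then show "x \<in> f ` V" using inj by (auto simp: inv_into_f_f)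
next
  fix x assume "x \<in> f ` V"
  then show "x \<in> inv_into (carrier G) f -` V \<inter> f ` carrier G"
    using assms inj by (auto simp: inv_into_f_f subset_iff)
qed

lemma openin_T': "openin T' U \<longleftrightarrow> (\<exists>V. openin T V \<and> U = f ` V)"
  unfolding T'_def openin_pullback_topology
  using openin_subset[of T] topspace_T vimage_inverse by metis

lemma topspace_T': "topspace T' = carrier G'"
proof -
  have "topspace T' = inv_into (carrier G) f -` carrier G \<inter> f ` carrier G"
    unfolding T'_def topspace_pullback_topology topspace_T ..
  also have "\<dots> = carrier G'" by (auto simp: carrier_G' inv_into_into)
  finally show ?thesis .
qed

lemma homeo: "homeomorphic_map T T' f"
proof (rule bijective_open_imp_homeomorphic_map)
  show "f ` topspace T = topspace T'" "inj_on f (topspace T)"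
    using inj by (auto simp: topspace_T topspace_T' carrier_G')
  show "open_map T T' f" by (auto simp: open_map_def openin_T')
  have "{x \<in> topspace T. f x \<in> f ` V} = V" if "openin T V" for V
    using inj openin_subset[OF that] unfolding topspace_T by (auto dest: inj_onD)
  then show "continuous_map T T' f"
    unfolding continuous_map_def by (auto simp: openin_T' topspace_T topspace_T' carrier_G')
qed

lemma homeo_inv: "continuous_map T' T (inv_into (carrier G) f)"
proof -
  have "continuous_map T' T (id \<circ> inv_into (carrier G) f)"
    unfolding T'_def by (rule continuous_map_pullback[OF continuous_map_id])
  then show ?thesis by simp
qed

lemma profinite_G': "profinite_group G' T'"
proof -
  let ?g = "inv_into (carrier G) f"
  note f = homeomorphic_imp_continuous_map[OF homeo]
  have *: "continuous_map (prod_topology T T) T (\<lambda>(x, y). x \<otimes> y)" "continuous_map T T (\<lambda>x. inv x)"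
    "compact_space T" "Hausdorff_space T" "totally_disconnected_space T"
    using profinite by (auto simp: profinite_group_def topological_group_def)
  have "continuous_map (prod_topology T' T') (prod_topology T T) (\<lambda>(x, y). (?g x, ?g y))"
    using homeo_inv by (simp add: continuous_map_prod_top)
  from continuous_map_compose[OF continuous_map_compose[OF this *(1)] f]
  have "continuous_map (prod_topology T' T') T' (\<lambda>(x, y). x \<otimes>\<^bsub>G'\<^esub> y)"
    by (simp add: o_def case_prod_unfold G'_def image_group_def)
  moreover have "continuous_map T' T' (\<lambda>x. inv\<^bsub>G'\<^esub> x)"
  proof -
    have "f (inv (?g x)) = inv\<^bsub>G'\<^esub> x" if "x \<in> topspace T'" for x
    proof -
      have x: "?g x \<in> carrier G" "f (?g x) = x"
        using that by (auto simp: topspace_T' carrier_G' inv_into_into f_inv_into_f)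
      have "f (inv (?g x)) = inv\<^bsub>G'\<^esub> (f (?g x))"
        using iso x(1) group_hom.hom_inv[of G G' f] is_group group_G'
        by (simp add: group_hom_def group_hom_axioms_def iso_def)
      with x show ?thesis by simp
    qed
    then show ?thesis
      using continuous_map_compose[OF continuous_map_compose[OF homeo_inv *(2)] f]
      by (auto intro: continuous_map_eq)
  qed
  moreover have "compact_space T'" "Hausdorff_space T'"
    using *(3,4) homeo homeomorphic_map_imp_homeomorphic_space homeomorphic_compact_space
      homeomorphic_Hausdorff_space by blast+
  moreover have "totally_disconnected_space T'"
    unfolding totally_disconnected_space_def
  proof (intro allI impI ballI)
    fix S x y assume S: "connectedin T' S" "x \<in> S" "y \<in> S"
    then have sub: "S \<subseteq> f ` carrier G" using connectedin_subset_topspace topspace_T' carrier_G' by blast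
    have "connectedin T (?g ` S)" using connectedin_continuous_map_image[OF homeo_inv S(1)] .
    then have "?g x = ?g y"
      using *(5)[unfolded totally_disconnected_space_def, rule_format] S by simp
    then show "x = y" by (rule inv_into_injective) (use sub S in auto)
  qed
  ultimately show ?thesis
    using topspace_T' group_G' by (simp add: profinite_group_def topological_group_def)
qed

lemma space_\<mu>: "space \<mu> = carrier G" and sets_\<mu>: "sets \<mu> = sigma_sets (carrier G) {U. openin T U}"
  using haar by (auto simp: normalized_haar_measure_def)

lemma space_\<mu>': "space \<mu>' = carrier G'"
  and sets_\<mu>'_sigma: "sets \<mu>' = sigma_sets (carrier G') {U. openin T' U}"
proof -
  have "{U. openin T' U} \<subseteq> Pow (f ` carrier G)"
    using openin_subset topspace_T' carrier_G' by blast
  then show "space \<mu>' = carrier G'" "sets \<mu>' = sigma_sets (carrier G') {U. openin T' U}"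
    by (simp_all add: \<mu>'_def carrier_G' space_measure_of_conv sets_measure_of)
qed

lemma vimage_image: "A \<subseteq> carrier G \<Longrightarrow> f -` (f ` A) \<inter> carrier G = A"
  using inj by (auto dest: inj_onD)

lemma measurable_f: "f \<in> measurable \<mu> (sigma (f ` carrier G) {U. openin T' U})"
proof (rule measurable_measure_of)
  show "{U. openin T' U} \<subseteq> Pow (f ` carrier G)"
    using openin_subset topspace_T' carrier_G' by blast
  show "f \<in> space \<mu> \<rightarrow> f ` carrier G" by (auto simp: space_\<mu>)
  fix U assume "U \<in> {U. openin T' U}"
  then obtain V where "openin T V" "U = f ` V" by (auto simp: openin_T')
  then have "f -` U \<inter> space \<mu> = V" using openin_subset[of T V] vimage_image by (simp add: space_\<mu> topspace_T)
  then show "f -` U \<inter> space \<mu> \<in> sets \<mu>" using \<open>openin T V\<close> by (auto simp: sets_\<mu>)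
qed

lemma measurable_inverse: "inv_into (carrier G) f \<in> measurable \<mu>' \<mu>"
proof (rule measurable_sigma_sets[OF sets_\<mu>])
  show "{U. openin T U} \<subseteq> Pow (carrier G)" using openin_subset[of T] by (auto simp: topspace_T)
  show "inv_into (carrier G) f \<in> space \<mu>' \<rightarrow> carrier G"
    by (auto simp: space_\<mu>' carrier_G' inv_into_into)
  fix V assume V: "V \<in> {U. openin T U}"
  then have "inv_into (carrier G) f -` V \<inter> space \<mu>' = f ` V"
    using openin_subset[of T V] vimage_inverse by (simp add: topspace_T space_\<mu>' carrier_G')
  then show "inv_into (carrier G) f -` V \<inter> space \<mu>' \<in> sets \<mu>'"
    using V by (auto simp: sets_\<mu>'_sigma openin_T')
qed

lemma image_in_sets_\<mu>'_iff:
  assumes "A \<subseteq> carrier G"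
  shows "f ` A \<in> sets \<mu>' \<longleftrightarrow> A \<in> sets \<mu>"
proof
  assume "f ` A \<in> sets \<mu>'"
  then have "f -` (f ` A) \<inter> space \<mu> \<in> sets \<mu>"
    using measurable_sets[OF measurable_f] by (simp add: \<mu>'_def)
  then show "A \<in> sets \<mu>" using vimage_image[OF assms] by (simp add: space_\<mu>)
next
  assume "A \<in> sets \<mu>"
  then have "inv_into (carrier G) f -` A \<inter> space \<mu>' \<in> sets \<mu>'"
    by (rule measurable_sets[OF measurable_inverse])
  moreover have "inv_into (carrier G) f -` A \<inter> space \<mu>' = f ` A"
    using vimage_inverse[OF assms] by (simp add: space_\<mu>' carrier_G')
  ultimately show "f ` A \<in> sets \<mu>'" by simp
qed

text \<open>For a set \<open>A\<close> that is not measurable both sides are 0, as its image is not measurable either; so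
  translates can be compared before they are known to be measurable.\<close>

lemma emeasure_image:
  assumes "A \<subseteq> carrier G"
  shows "emeasure \<mu>' (f ` A) = emeasure \<mu> A"
proof (cases "A \<in> sets \<mu>")
  case True
  then have "f ` A \<in> sets \<mu>'" using image_in_sets_\<mu>'_iff[OF assms] by simp
  then have "emeasure \<mu>' (f ` A) = emeasure \<mu> (f -` (f ` A) \<inter> space \<mu>)"
    unfolding \<mu>'_def by (intro emeasure_distr measurable_f) simp
  then show ?thesis using vimage_image[OF assms] by (simp add: space_\<mu>)
next
  case False
  then show ?thesis using image_in_sets_\<mu>'_iff[OF assms] by (simp add: emeasure_notin_sets)
qed

lemma subset_G'E:
  assumes "B \<subseteq> carrier G'" obtains A where "A \<subseteq> carrier G" "B = f ` A"
  using assms unfolding carrier_G' by (meson subset_imageE)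

lemma haar_G': "normalized_haar_measure G' T' \<mu>'"
  unfolding normalized_haar_measure_def
proof (intro conjI ballI allI impI)
  show "space \<mu>' = carrier G'" by (rule space_\<mu>')
  show "sets \<mu>' = sigma_sets (carrier G') {U. openin T' U}" by (rule sets_\<mu>'_sigma)
  show "emeasure \<mu>' (carrier G') = 1"
    using haar emeasure_image[of "carrier G"] by (simp add: carrier_G' normalized_haar_measure_def)
  show "emeasure \<mu>' (g <#\<^bsub>G'\<^esub> B) = emeasure \<mu>' B" if g: "g \<in> carrier G'" and B: "B \<in> sets \<mu>'" for g B
  proof -
    obtain A where A: "A \<subseteq> carrier G" "B = f ` A"
      using sets.sets_into_space[OF B] unfolding space_\<mu>' by (rule subset_G'E)
    obtain a where a: "a \<in> carrier G" "g = f a" using g by (auto simp: carrier_G')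
    have "f a \<otimes>\<^bsub>G'\<^esub> f x = f (a \<otimes> x)" if "x \<in> A" for x
      using iso a(1) A(1) that by (auto simp: iso_def hom_mult)
    then have "g <#\<^bsub>G'\<^esub> B = f ` (a <# A)"
      unfolding l_coset_def a(2) A(2) by (auto simp: image_iff)
    moreover have "a <# A \<subseteq> carrier G" by (rule l_coset_subset_G[OF A(1) a(1)])
    moreover have "A \<in> sets \<mu>" using B A image_in_sets_\<mu>'_iff by blast
    ultimately show ?thesis
      using haar a(1) A emeasure_image by (simp add: normalized_haar_measure_def)
  qed
  show "emeasure \<mu>' B = (INF U\<in>{U. openin T' U \<and> B \<subseteq> U}. emeasure \<mu>' U)" if B: "B \<in> sets \<mu>'" for B
  proof -
    obtain A where A: "A \<subseteq> carrier G" "B = f ` A"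
      using sets.sets_into_space[OF B] unfolding space_\<mu>' by (rule subset_G'E)
    have sub: "U \<subseteq> carrier G" if "openin T U" for U using openin_subset[OF that] topspace_T by simp
    have "A \<in> sets \<mu>" using B A image_in_sets_\<mu>'_iff by blast
    then have "emeasure \<mu> A = (INF U\<in>{U. openin T U \<and> A \<subseteq> U}. emeasure \<mu> U)"
      using haar unfolding normalized_haar_measure_def by blast
    also have "\<dots> = (INF U\<in>{U. openin T U \<and> A \<subseteq> U}. emeasure \<mu>' (f ` U))"
      using sub by (intro INF_cong refl) (simp add: emeasure_image)
    also have "\<dots> = (INF U\<in>(`) f ` {U. openin T U \<and> A \<subseteq> U}. emeasure \<mu>' U)"
      by (simp add: image_comp)
    also have "(`) f ` {U. openin T U \<and> A \<subseteq> U} = {U. openin T' U \<and> B \<subseteq> U}"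
      using inj A sub by (auto simp: openin_T' inj_on_image_subset_iff)
    finally show ?thesis using emeasure_image[OF A(1)] A(2) by simp
  qed
  show "emeasure \<mu>' W = (SUP K\<in>{K. compactin T' K \<and> K \<subseteq> W}. emeasure \<mu>' K)" if W: "openin T' W" for W
  proof -
    obtain U where U: "openin T U" "W = f ` U" using W by (auto simp: openin_T')
    have UG: "U \<subseteq> carrier G" using openin_subset[OF U(1)] topspace_T by simp
    have "emeasure \<mu> U = (SUP K\<in>{K. compactin T K \<and> K \<subseteq> U}. emeasure \<mu> K)"
      using haar U(1) unfolding normalized_haar_measure_def by blast
    also have "\<dots> = (SUP K\<in>{K. compactin T K \<and> K \<subseteq> U}. emeasure \<mu>' (f ` K))"
      using UG by (intro SUP_cong refl) (auto simp: emeasure_image)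
    also have "\<dots> = (SUP K\<in>(`) f ` {K. compactin T K \<and> K \<subseteq> U}. emeasure \<mu>' K)"
      by (simp add: image_comp)
    also have "(`) f ` {K. compactin T K \<and> K \<subseteq> U} = {K. compactin T' K \<and> K \<subseteq> W}"
    proof (intro equalityI subsetI)
      fix L assume "L \<in> {K. compactin T' K \<and> K \<subseteq> W}"
      then obtain K where "K \<subseteq> U" "L = f ` K" "compactin T' L" using U(2) by (auto dest: subset_imageE)
      then show "L \<in> (`) f ` {K. compactin T K \<and> K \<subseteq> U}"
        using homeomorphic_map_compactness[OF homeo, of K] UG topspace_T by auto
    next
      fix L assume "L \<in> (`) f ` {K. compactin T K \<and> K \<subseteq> U}"
      then show "L \<in> {K. compactin T' K \<and> K \<subseteq> W}"
        using homeomorphic_map_compactness[OF homeo] compactin_subset_topspace U(2) by auto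
    qed
    finally show ?thesis using emeasure_image[OF UG] U(2) by simp
  qed
qed

end

section \<open>Products of finite groups and their Haar measure\<close>

text \<open>The Borel \<open>\<sigma>\<close>-algebra, rather than that of all sets of reals, makes countable products
  Borel measures on \<open>nat \<Rightarrow> real\<close>, where finite Borel measures are regular.\<close>

definition uniform_real :: "real set \<Rightarrow> real measure" where
  "uniform_real A = distr (measure_pmf (pmf_of_set A)) borel (\<lambda>x. x)"

lemma uniform_real_simps [simp, measurable_cong]:
  "sets (uniform_real A) = sets borel" "space (uniform_real A) = UNIV"
  by (simp_all add: uniform_real_def)

lemma prob_space_uniform_real: "prob_space (uniform_real A)"
  unfolding uniform_real_def by (rule prob_space.prob_space_distr) (auto simp: measure_pmf.prob_space_axioms)

lemma emeasure_uniform_real: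
  "B \<in> sets borel \<Longrightarrow> emeasure (uniform_real A) B = emeasure (measure_pmf (pmf_of_set A)) B"
  by (simp add: uniform_real_def emeasure_distr)

lemma measure_uniform_real:
  assumes "finite A" "A \<noteq> {}" "B \<subseteq> A"
  shows "measure (uniform_real A) B = card B / card A"
proof -
  have "B \<in> sets borel"
    using assms finite_subset by (blast intro: borel_closed finite_imp_closed)
  then have "measure (uniform_real A) B = measure (measure_pmf (pmf_of_set A)) B"
    by (simp add: measure_def emeasure_uniform_real)
  also have "\<dots> = card B / card A"
    using assms by (simp add: measure_pmf_of_set Int_absorb1)
  finally show ?thesis .
qed

lemma borel_measurable_finite_change:
  fixes f :: "real \<Rightarrow> real"
  assumes "finite A" "\<And>x. x \<notin> A \<Longrightarrow> f x = x"
  shows "f \<in> borel_measurable borel"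
proof (rule borel_measurableI)
  fix S :: "real set" assume "open S"
  have "f -` S \<inter> space borel = (S - A) \<union> (A \<inter> f -` S)"
    by (auto simp: assms(2)) (metis assms(2))
  moreover have "S - A \<in> sets borel"
    using \<open>open S\<close> assms(1) finite_imp_closed by (blast intro: borel_open)
  moreover have "A \<inter> f -` S \<in> sets borel"
    using assms(1) by (intro borel_closed finite_imp_closed) simp
  ultimately show "f -` S \<inter> space borel \<in> sets borel"
    by (simp only: sets.Un)
qed

lemma emeasure_uniform_real_bij:
  assumes A: "finite A" "A \<noteq> {}" and f: "bij_betw f A A" "\<And>x. x \<notin> A \<Longrightarrow> f x = x"
    and B: "B \<in> sets borel"
  shows "emeasure (uniform_real A) (f -` B) = emeasure (uniform_real A) B"
proof -
  have "f -` B \<in> sets borel"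
    using measurable_sets[OF borel_measurable_finite_change[OF A(1) f(2)] B] by simp
  then have "emeasure (uniform_real A) (f -` B) = emeasure (measure_pmf (map_pmf f (pmf_of_set A))) B"
    by (simp add: emeasure_uniform_real)
  also have "map_pmf f (pmf_of_set A) = pmf_of_set A"
    by (rule map_pmf_of_set_bij_betw[OF f(1) A(2,1)])
  finally show ?thesis using B by (simp add: emeasure_uniform_real)
qed

locale finite_group_sequence =
  fixes H :: "nat \<Rightarrow> real monoid"
  assumes H: "\<And>n. group (H n)" and fin: "\<And>n. finite (carrier (H n))"
begin

sublocale H: group "H n" for n by (rule H)

abbreviation G where "G \<equiv> product_group UNIV H"

definition T where "T = product_topology (\<lambda>n. discrete_topology (carrier (H n))) UNIV"

definition P where "P = PiM UNIV (\<lambda>n. uniform_real (carrier (H n)))"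

definition \<mu> where "\<mu> = restrict_space P (carrier G)"

sublocale G: group G by (rule product_group) (rule H)

lemma carrier_G: "carrier G = Pi UNIV (\<lambda>n. carrier (H n))"
  by (simp add: PiE_UNIV_domain)

lemma topspace_T: "topspace T = carrier G"
  by (simp add: T_def)

lemma projection_continuous: "continuous_map T (discrete_topology (carrier (H n))) (\<lambda>x. x n)"
  unfolding T_def by (rule continuous_map_product_projection) simp

text \<open>Finite sets of reals are discrete, so open and compact subsets of \<open>G\<close> can be compared with those of
  \<open>nat \<Rightarrow> real\<close>.\<close>

lemma T_eq_subtopology: "T = subtopology euclidean (carrier G)"
proof -
  have "discrete_topology (carrier (H n)) = subtopology euclidean (carrier (H n))" for n
    using fin by (intro finite_t1_space_imp_discrete_topology[symmetric])
      (auto intro!: Hausdorff_imp_t1_space Hausdorff_space_subtopology)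
  then show ?thesis
    unfolding T_def by (simp add: subtopology_product_topology[symmetric] euclidean_product_topology)
qed

lemma profinite: "profinite_group G T"
proof -
  have "continuous_map (prod_topology T T) (discrete_topology (carrier (H k))) (\<lambda>z. fst z k \<otimes>\<^bsub>H k\<^esub> snd z k)" for k
  proof -
    let ?D = "discrete_topology (carrier (H k))"
    have "continuous_map (prod_topology T T) ?D (\<lambda>z. fst z k)"
      "continuous_map (prod_topology T T) ?D (\<lambda>z. snd z k)"
      using continuous_map_compose[OF continuous_map_fst projection_continuous]
        continuous_map_compose[OF continuous_map_snd projection_continuous] by (auto simp: o_def)
    then have "continuous_map (prod_topology T T) (prod_topology ?D ?D) (\<lambda>z. (fst z k, snd z k))"
      by (simp add: continuous_map_pairedI)
    moreover have "continuous_map (prod_topology ?D ?D) ?D (\<lambda>(a, b). a \<otimes>\<^bsub>H k\<^esub> b)"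
      unfolding prod_topology_discrete_topology[symmetric] by auto
    ultimately show ?thesis
      using continuous_map_compose by (fastforce simp: o_def)
  qed
  then have "continuous_map (prod_topology T T) T (\<lambda>(x, y). x \<otimes>\<^bsub>G\<^esub> y)"
    unfolding T_def continuous_map_componentwise_UNIV by (simp add: case_prod_unfold)
  moreover have "continuous_map T T (\<lambda>x. inv\<^bsub>G\<^esub> x)"
  proof -
    have "continuous_map T (discrete_topology (carrier (H k))) (\<lambda>x. inv\<^bsub>H k\<^esub> x k)" for k
      using continuous_map_compose[OF projection_continuous[of k], of "discrete_topology (carrier (H k))" "\<lambda>a. inv\<^bsub>H k\<^esub> a"]
      by (auto simp: o_def)
    then have "continuous_map T T (\<lambda>x. \<lambda>k. inv\<^bsub>H k\<^esub> x k)"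
      unfolding T_def continuous_map_componentwise_UNIV by simp
    then show ?thesis by (rule continuous_map_eq) (auto simp: topspace_T H)
  qed
  moreover have "compact_space T"
    unfolding T_def compact_space_product_topology
    by (simp add: compact_space_discrete_topology fin)
  moreover have "Hausdorff_space T"
    unfolding T_def Hausdorff_space_product_topology by simp
  moreover have "totally_disconnected_space T"
    unfolding totally_disconnected_space_def
  proof (intro allI impI ballI ext)
    fix S x y n assume "connectedin T S" "x \<in> S" "y \<in> S"
    then have "connectedin (discrete_topology (carrier (H n))) ((\<lambda>x. x n) ` S)"
      using connectedin_continuous_map_image projection_continuous by blast
    then obtain a where "(\<lambda>x. x n) ` S \<subseteq> {a}" by (auto simp: connectedin_discrete_topology)
    then show "x n = y n" using \<open>x \<in> S\<close> \<open>y \<in> S\<close> by auto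
  qed
  ultimately show ?thesis
    using topspace_T G.is_group by (simp add: profinite_group_def topological_group_def)
qed

lemma sets_P: "sets P = sets borel"
proof -
  have "sets P = sets (PiM UNIV (\<lambda>n::nat. borel :: real measure))"
    unfolding P_def by (rule sets_PiM_cong) simp_all
  then show ?thesis by (simp add: sets_PiM_equal_borel)
qed

sublocale P: prob_space P
  unfolding P_def by (rule prob_space_PiM) (rule prob_space_uniform_real)

lemma space_P: "space P = UNIV"
  by (simp add: P_def space_PiM PiE_UNIV_domain)

text \<open>The box is the decreasing intersection of the cylinders that restrict finitely many coordinates.\<close>

lemma measure_P_box:
  assumes E: "\<And>n. E n \<in> sets borel"
  shows "Pi UNIV E \<in> sets P"
    "(\<lambda>m. \<Prod>n\<le>m. measure (uniform_real (carrier (H n))) (E n)) \<longlonglongrightarrow> measure P (Pi UNIV E)"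
proof -
  let ?M = "\<lambda>n. uniform_real (carrier (H n))"
  interpret pp: product_prob_space ?M "UNIV :: nat set"
    by (intro product_prob_spaceI prob_space_uniform_real)
  let ?E = "\<lambda>m. prod_emb UNIV ?M {..m} (Pi\<^sub>E {..m} E)"
  have eq: "Pi UNIV E = (\<Inter>m. ?E m)"
    by (auto simp: prod_emb_def Pi_iff)
  have sets: "range ?E \<subseteq> sets P"
    unfolding P_def using E by auto
  then show "Pi UNIV E \<in> sets P" unfolding eq by auto
  have "decseq ?E" by (auto simp: prod_emb_def Pi_iff decseq_def)
  then have "(\<lambda>m. measure P (?E m)) \<longlonglongrightarrow> measure P (Pi UNIV E)"
    unfolding eq using sets by (intro P.finite_Lim_measure_decseq)
  moreover have "measure P (?E m) = (\<Prod>n\<le>m. measure (?M n) (E n))" for m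
    unfolding P_def using E by (simp add: pp.measure_PiM_emb)
  ultimately show "(\<lambda>m. \<Prod>n\<le>m. measure (?M n) (E n)) \<longlonglongrightarrow> measure P (Pi UNIV E)" by simp
qed

lemma borel_subset_carrier: "B \<subseteq> carrier (H n) \<Longrightarrow> B \<in> sets borel"
  using fin[of n] finite_subset by (blast intro: borel_closed finite_imp_closed)

lemma carrier_sets: "carrier G \<in> sets P"
  unfolding carrier_G by (rule measure_P_box) (auto intro: borel_subset_carrier)

lemma space_\<mu>: "space \<mu> = carrier G"
  by (simp add: \<mu>_def space_restrict_space space_P)

lemma emeasure_\<mu>: "A \<subseteq> carrier G \<Longrightarrow> emeasure \<mu> A = emeasure P A"
  unfolding \<mu>_def by (rule emeasure_restrict_space) (use carrier_sets in \<open>auto simp: space_P\<close>)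

lemma sets_\<mu>: "A \<in> sets \<mu> \<longleftrightarrow> A \<in> sets P \<and> A \<subseteq> carrier G"
  unfolding \<mu>_def using carrier_sets by (subst sets_restrict_space_iff) (auto simp: space_P)

lemma measure_\<mu>_box:
  assumes "\<And>n. E n \<subseteq> carrier (H n)"
  shows "(\<lambda>m. \<Prod>n\<le>m. real (card (E n)) / card (carrier (H n))) \<longlonglongrightarrow> measure \<mu> (Pi UNIV E)"
proof -
  have E: "E n \<in> sets borel" for n using borel_subset_carrier assms .
  have sub: "Pi UNIV E \<subseteq> carrier G" using assms by (auto simp: carrier_G)
  have "measure \<mu> (Pi UNIV E) = measure P (Pi UNIV E)"
    by (simp add: measure_def emeasure_\<mu>[OF sub])
  moreover have "measure (uniform_real (carrier (H n))) (E n) = real (card (E n)) / card (carrier (H n))" for n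
    using assms fin by (intro measure_uniform_real) auto
  ultimately show "(\<lambda>m. \<Prod>n\<le>m. real (card (E n)) / card (carrier (H n))) \<longlonglongrightarrow> measure \<mu> (Pi UNIV E)"
    using measure_P_box(2)[of E] E by simp
qed

lemma emeasure_carrier: "emeasure \<mu> (carrier G) = 1"
proof -
  have "(\<lambda>m. \<Prod>n\<le>m. real (card (carrier (H n))) / card (carrier (H n))) \<longlonglongrightarrow> measure \<mu> (carrier G)"
    unfolding carrier_G by (rule measure_\<mu>_box) simp
  moreover have "card (carrier (H n)) \<noteq> 0" for n using fin[of n] by auto
  ultimately have "(\<lambda>m. 1) \<longlonglongrightarrow> measure \<mu> (carrier G)" by simp
  then have "measure \<mu> (carrier G) = 1" using LIMSEQ_unique tendsto_const by blast
  moreover have "emeasure \<mu> (carrier G) = ennreal (measure \<mu> (carrier G))"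
    using P.emeasure_eq_measure by (simp add: emeasure_\<mu> measure_def)
  ultimately show ?thesis by simp
qed

text \<open>Left multiplication, continued by the identity to all reals so that it acts on the whole space of
  \<open>P\<close>.\<close>

definition translation :: "(nat \<Rightarrow> real) \<Rightarrow> nat \<Rightarrow> real \<Rightarrow> real" where
  "translation g n r = (if r \<in> carrier (H n) then g n \<otimes>\<^bsub>H n\<^esub> r else r)"

lemma bij_translation:
  assumes "g \<in> carrier G" shows "bij_betw (translation g n) (carrier (H n)) (carrier (H n))"
proof -
  have "bij_betw (\<lambda>r. g n \<otimes>\<^bsub>H n\<^esub> r) (carrier (H n)) (carrier (H n))"
    using H.surj_const_mult[of "g n" n] H.inj_on_cmult[of "g n" n] assms
    by (auto simp: bij_betw_def PiE_iff)
  then show ?thesis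
    by (rule bij_betw_cong[THEN iffD1, rotated]) (simp add: translation_def)
qed

text \<open>A product measure is determined on cylinders. There the claim reduces to single coordinates, where
  translation permutes the finite group and preserves the uniform distribution.\<close>

lemma translation_invariant:
  assumes g: "g \<in> carrier G" and A: "A \<in> sets P"
  shows "emeasure P ((\<lambda>x n. translation g n (x n)) -` A) = emeasure P A"
proof -
  let ?M = "\<lambda>n. uniform_real (carrier (H n))"
  interpret pp: product_prob_space ?M "UNIV :: nat set"
    by (intro product_prob_spaceI prob_space_uniform_real)
  let ?t = "\<lambda>x n. translation g n (x n)"
  have meas: "translation g n \<in> measurable (?M n) (?M n)" for n
    using borel_measurable_finite_change[of "carrier (H n)" "translation g n"] fin
    by (simp add: translation_def measurable_cong_sets[OF uniform_real_simps(1) uniform_real_simps(1)])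
  have t: "?t \<in> measurable P P"
    unfolding P_def
  proof (rule measurable_PiM_single')
    fix n
    show "(\<lambda>x. translation g n (x n)) \<in> measurable (PiM UNIV ?M) (?M n)"
      by (rule measurable_compose[OF measurable_component_singleton[of n UNIV ?M] meas[of n]]) simp
  qed (auto simp: space_PiM PiE_UNIV_domain)
  have "P = distr P P ?t"
  proof (rule measure_eqI_PiM_infinite[of _ UNIV ?M])
    fix B :: "nat \<Rightarrow> real set" and J :: "nat set"
    assume J: "finite J" and B: "\<And>i. i \<in> J \<Longrightarrow> B i \<in> sets (?M i)"
    let ?X = "prod_emb UNIV ?M J (Pi\<^sub>E J B)"
    have X: "?X \<in> sets P" unfolding P_def using J B by (intro sets_PiM_I) auto
    have B': "translation g i -` B i \<in> sets (?M i)" if "i \<in> J" for i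
      using measurable_sets[OF meas B[OF that]] by simp
    have "emeasure (distr P P ?t) ?X = emeasure P (?t -` ?X \<inter> space P)"
      using t X by (rule emeasure_distr)
    also have "?t -` ?X \<inter> space P = prod_emb UNIV ?M J (Pi\<^sub>E J (\<lambda>i. translation g i -` B i))"
      by (auto simp: prod_emb_def space_P PiE_iff)
    also have "emeasure P \<dots> = (\<Prod>i\<in>J. emeasure (?M i) (translation g i -` B i))"
      unfolding P_def using J B' by (intro pp.emeasure_PiM_emb) auto
    also have "\<dots> = (\<Prod>i\<in>J. emeasure (?M i) (B i))"
      using bij_translation[OF g] fin B
      by (intro prod.cong emeasure_uniform_real_bij) (auto simp: translation_def)
    also have "\<dots> = emeasure P ?X"
      unfolding P_def using J B by (intro pp.emeasure_PiM_emb[symmetric]) auto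
    finally show "emeasure P ?X = emeasure (distr P P ?t) ?X" by simp
  qed (simp_all add: P_def P.finite_measure_axioms[unfolded P_def])
  then have "emeasure P A = emeasure (distr P P ?t) A" by simp
  also have "\<dots> = emeasure P (?t -` A)"
    using t A by (simp add: emeasure_distr space_P)
  finally show ?thesis by simp
qed

lemma emeasure_left_coset:
  assumes g: "g \<in> carrier G" and A: "A \<in> sets \<mu>"
  shows "emeasure \<mu> (g <#\<^bsub>G\<^esub> A) = emeasure \<mu> A"
proof -
  have AG: "A \<subseteq> carrier G" and AP: "A \<in> sets P" using A by (auto simp: sets_\<mu>)
  define g' where "g' = inv\<^bsub>G\<^esub> g"
  have g': "g' \<in> carrier G" unfolding g'_def using g by (rule G.inv_closed)
  have t: "(\<lambda>n. translation g' n (x n)) = g' \<otimes>\<^bsub>G\<^esub> x" if "x \<in> carrier G" for x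
    using that by (auto simp: translation_def restrict_def PiE_iff)
  have "(\<lambda>x n. translation g' n (x n)) -` A = g <#\<^bsub>G\<^esub> A"
  proof (intro equalityI subsetI)
    fix x assume "x \<in> (\<lambda>x n. translation g' n (x n)) -` A"
    then have x: "(\<lambda>n. translation g' n (x n)) \<in> A" by simp
    have "x \<in> carrier G"
    proof -
      have "x n \<in> carrier (H n)" for n
        using x AG unfolding carrier_G by (auto simp: translation_def split: if_splits dest!: subsetD PiE_mem Pi_mem[of _ _ _ n])
      then show ?thesis by (auto simp: carrier_G)
    qed
    with t x have "g' \<otimes>\<^bsub>G\<^esub> x \<in> A" by simp
    moreover have "x = g \<otimes>\<^bsub>G\<^esub> (g' \<otimes>\<^bsub>G\<^esub> x)"
      unfolding g'_def using g \<open>x \<in> carrier G\<close> by (metis G.inv_solve_left' G.inv_closed G.m_closed)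
    ultimately show "x \<in> g <#\<^bsub>G\<^esub> A" unfolding l_coset_def by blast
  next
    fix x assume "x \<in> g <#\<^bsub>G\<^esub> A"
    then obtain a where a: "a \<in> A" "x = g \<otimes>\<^bsub>G\<^esub> a" unfolding l_coset_def by blast
    then have "a \<in> carrier G" "x \<in> carrier G" using AG g G.m_closed by auto
    moreover have "g' \<otimes>\<^bsub>G\<^esub> x = a"
      unfolding g'_def a(2) using g \<open>a \<in> carrier G\<close> by (metis G.inv_solve_left G.m_closed)
    ultimately show "x \<in> (\<lambda>x n. translation g' n (x n)) -` A" using t[of x] a(1) by simp
  qed
  then have "emeasure P (g <#\<^bsub>G\<^esub> A) = emeasure P A"
    using translation_invariant[OF g' AP] by simp
  then show ?thesis
    using emeasure_\<mu>[OF AG] emeasure_\<mu>[OF G.l_coset_subset_G[OF AG g]] by simp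
qed

text \<open>Both regularity conditions are inherited from \<open>P\<close>: the relatively open sets are the traces of open
  sets, and a subset of \<open>G\<close> is compact in \<open>G\<close> exactly if it is compact.\<close>

lemma haar: "normalized_haar_measure G T \<mu>"
  unfolding normalized_haar_measure_def
proof (intro conjI ballI allI impI)
  have op: "openin T U \<longleftrightarrow> (\<exists>V. open V \<and> U = carrier G \<inter> V)" for U
    unfolding T_eq_subtopology openin_subtopology by auto
  have reg: "sets P = sets borel" "emeasure P (space P) \<noteq> \<infinity>"
    using sets_P by (auto simp: P.emeasure_space_1)
  show "space \<mu> = carrier G" by (rule space_\<mu>)
  have "sets \<mu> = (\<inter>) (carrier G) ` sigma_sets UNIV {S. open S}"
    unfolding \<mu>_def sets_restrict_space sets_P by (simp add: borel_def)
  also have "\<dots> = sigma_sets (carrier G) ((\<inter>) (carrier G) ` {S. open S})"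
    using carrier_sets unfolding sets_P by (intro sigma_sets_Int) (auto simp: borel_def)
  also have "(\<inter>) (carrier G) ` {S. open S} = {U. openin T U}"
    unfolding op by auto
  finally show "sets \<mu> = sigma_sets (carrier G) {U. openin T U}" .
  show "emeasure \<mu> (carrier G) = 1" by (rule emeasure_carrier)
  show "emeasure \<mu> (g <#\<^bsub>G\<^esub> A) = emeasure \<mu> A" if "g \<in> carrier G" "A \<in> sets \<mu>" for g A
    using emeasure_left_coset that .
  have open_sub: "U \<subseteq> carrier G" "U \<in> sets P" if "openin T U" for U
    using that carrier_sets unfolding op sets_P by auto
  show "emeasure \<mu> A = (INF U\<in>{U. openin T U \<and> A \<subseteq> U}. emeasure \<mu> U)" if A: "A \<in> sets \<mu>" for A
  proof (rule antisym)
    show "emeasure \<mu> A \<le> (INF U\<in>{U. openin T U \<and> A \<subseteq> U}. emeasure \<mu> U)"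
      using open_sub by (auto intro!: INF_greatest emeasure_mono simp: sets_\<mu>)
    have "(INF U\<in>{U. openin T U \<and> A \<subseteq> U}. emeasure \<mu> U) \<le> (INF U\<in>{U. A \<subseteq> U \<and> open U}. emeasure P U)"
    proof (rule INF_mono)
      fix V assume V: "V \<in> {U. A \<subseteq> U \<and> open U}"
      then have "emeasure \<mu> (carrier G \<inter> V) \<le> emeasure P V"
        by (simp add: emeasure_\<mu> emeasure_mono sets_P)
      moreover have "carrier G \<inter> V \<in> {U. openin T U \<and> A \<subseteq> U}"
        using V A op by (auto simp: sets_\<mu>)
      ultimately show "\<exists>U\<in>{U. openin T U \<and> A \<subseteq> U}. emeasure \<mu> U \<le> emeasure P V" by blast
    qed
    also have "\<dots> = emeasure P A"
      using A sets_P by (intro outer_regular[symmetric] reg) (auto simp: sets_\<mu>)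
    also have "\<dots> = emeasure \<mu> A" using A by (simp add: sets_\<mu> emeasure_\<mu>)
    finally show "(INF U\<in>{U. openin T U \<and> A \<subseteq> U}. emeasure \<mu> U) \<le> emeasure \<mu> A" .
  qed
  show "emeasure \<mu> U = (SUP K\<in>{K. compactin T K \<and> K \<subseteq> U}. emeasure \<mu> K)" if U: "openin T U" for U
  proof -
    have "{K. compactin T K \<and> K \<subseteq> U} = {K. K \<subseteq> U \<and> compact K}"
      unfolding T_eq_subtopology using open_sub[OF U] by (auto simp: compactin_subtopology)
    moreover have "emeasure P U = (SUP K\<in>{K. K \<subseteq> U \<and> compact K}. emeasure P K)"
      using open_sub[OF U] sets_P by (intro inner_regular reg) auto
    moreover have "emeasure \<mu> K = emeasure P K" if "K \<subseteq> U" for K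
      using that open_sub[OF U] by (intro emeasure_\<mu>) auto
    ultimately show ?thesis by (simp cong: SUP_cong_simp)
  qed
qed

end

section \<open>Products whose class set is not closed\<close>

text \<open>A sequence of reals is determined by the Dedekind cuts of its entries.\<close>

lemma injective_sequence_code: "\<exists>f :: (nat \<Rightarrow> real) \<Rightarrow> nat set. inj f"
proof -
  define f where "f = (\<lambda>x :: nat \<Rightarrow> real. {prod_encode (n, to_nat (r :: rat)) | n r. of_rat r < x n})"
  have mem: "prod_encode (n, to_nat r) \<in> f x \<longleftrightarrow> of_rat r < x n" for n r x
    by (auto simp: f_def)
  have less: "\<exists>k. k \<in> f y \<and> k \<notin> f x" if xy: "x n < y n" for x y n
  proof -
    obtain r where "x n < of_rat r" "of_rat r < y n" using of_rat_dense[OF xy] by blast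
    then show ?thesis using mem by (intro exI[of _ "prod_encode (n, to_nat r)"]) auto
  qed
  have "inj f"
  proof (intro injI ext)
    fix x y n assume eq: "f x = f y"
    show "x n = y n"
    proof (rule ccontr)
      assume "x n \<noteq> y n"
      then consider "x n < y n" | "y n < x n" by linarith
      then show False using less[of x n y] less[of y n x] eq by cases auto
    qed
  qed
  then show ?thesis by blast
qed

lemma prod_one_minus_half_powers: "(\<Prod>n\<le>m. 1 - 1 / 2 ^ (n + 2)) \<ge> (1 / 2 :: real)"
proof -
  have "(\<Sum>n\<le>m. 1 / 2 ^ (n + 2)) = (1 / 2 :: real) - 1 / 2 ^ (m + 2)"
    by (induction m) (simp_all add: field_simps)
  then have "(\<Sum>n\<le>m. 1 / 2 ^ (n + 2)) \<le> (1 / 2 :: real)" by simp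
  moreover have "1 - (\<Sum>n\<le>m. 1 / 2 ^ (n + 2)) \<le> (\<Prod>n\<le>m. 1 - 1 / 2 ^ (n + 2) :: real)"
  proof (rule Weierstrass_prod_ineq)
    have "(1 :: real) \<le> 2 ^ (n + 2)" for n :: nat by (rule one_le_power) simp
    then show "1 / 2 ^ (n + 2) \<in> {0..1 :: real}" for n :: nat by simp
  qed
  ultimately show ?thesis by linarith
qed

text \<open>Replacing the entries of \<open>h\<close> from position \<open>k\<close> on by identities changes the measure of the
  partner set from \<open>0\<close> to a positive number: finitely many positive factors are followed by a tail of
  factors at least \<open>1 - 1 / 2 ^ (n + 2)\<close>, whose product is at least \<open>1 / 2\<close>. As \<open>k\<close> grows these
  elements converge to \<open>h\<close>.\<close>

lemma class_set_not_closed: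
  assumes form: "group_formation \<F>"
    and gap: "\<And>n. \<exists>(K :: real monoid) h. partner_gap \<F> K h (1 / 2 ^ (n + 2)) \<delta>"
    and \<delta>: "\<delta> < 1" and large: "(UNIV :: nat set set) \<lesssim> (UNIV :: 'a set)"
  shows "\<exists>(G :: 'a monoid) T \<mu>. profinite_group G T \<and> normalized_haar_measure G T \<mu> \<and>
    \<not> closedin T (class_set \<F> G T \<mu>)"
proof -
  obtain H h where gap: "\<And>n. partner_gap \<F> (H n :: real monoid) (h n) (1 / 2 ^ (n + 2)) \<delta>"
    using gap by metis
  interpret S: finite_group_sequence H
    using gap by (intro finite_group_sequence.intro) (auto simp: partner_gap_def)
  obtain a where a: "inj (a :: nat set \<Rightarrow> 'a)" using large by (auto simp: lepoll_def)
  obtain b where b: "inj (b :: (nat \<Rightarrow> real) \<Rightarrow> nat set)" using injective_sequence_code by blast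
  define f where "f = a \<circ> b"
  have f: "inj f" unfolding f_def using a b by (rule inj_compose)
  interpret tr: group_transport S.G S.T S.\<mu> f
    using S.G.is_group S.profinite S.haar inj_on_subset[OF f subset_UNIV]
    by (intro group_transport.intro group_transport_axioms.intro)
  define \<pi> where "\<pi> = (\<lambda>n x. inv_into (carrier S.G) f x n)"
  have \<pi>: "\<pi> n (f x) = x n" if "x \<in> carrier S.G" for n x
    unfolding \<pi>_def using that f by (simp only: inv_into_f_f[OF tr.inj])
  interpret sp: separated_profinite_formation tr.G' tr.T' H \<pi> \<F>
  proof (intro separated_profinite_formation.intro separated_profinite.intro form)
    show "profinite_group tr.G' tr.T'" by (rule tr.profinite_G')
    show "group (H n)" for n by (rule S.H)
    show "\<pi> n \<in> hom tr.G' (H n)" for n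
    proof (rule homI)
      fix x y assume "x \<in> carrier tr.G'" "y \<in> carrier tr.G'"
      then obtain u v where uv: "u \<in> carrier S.G" "x = f u" "v \<in> carrier S.G" "y = f v"
        by (auto simp only: tr.carrier_G' image_iff)
      then show "\<pi> n x \<in> carrier (H n)" using \<pi> by (auto simp: PiE_iff)
      have "x \<otimes>\<^bsub>tr.G'\<^esub> y = f (u \<otimes>\<^bsub>S.G\<^esub> v)"
        using hom_mult[of f S.G tr.G' u v] tr.iso uv by (simp only: iso_def mem_Collect_eq)
      then show "\<pi> n (x \<otimes>\<^bsub>tr.G'\<^esub> y) = \<pi> n x \<otimes>\<^bsub>H n\<^esub> \<pi> n y"
        using \<pi> uv S.G.m_closed[OF uv(1,3)] by simp
    qed
    show "continuous_map tr.T' (discrete_topology (carrier (H n))) (\<pi> n)" for n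
      using continuous_map_compose[OF tr.homeo_inv S.projection_continuous[of n]]
      by (simp only: \<pi>_def o_def)
    fix x assume x: "x \<in> carrier tr.G'" "\<And>n. \<pi> n x = \<one>\<^bsub>H n\<^esub>"
    then obtain u where u: "u \<in> carrier S.G" "x = f u" by (auto simp only: tr.carrier_G' image_iff)
    then have "u = \<one>\<^bsub>S.G\<^esub>" using \<pi> x(2) by (auto simp: fun_eq_iff)
    moreover have "f \<one>\<^bsub>S.G\<^esub> = \<one>\<^bsub>tr.G'\<^esub>"
      by (simp only: tr.G'_def image_group_one)
    ultimately show "x = \<one>\<^bsub>tr.G'\<^esub>" using u(2) by simp
  qed
  define E where "E = (\<lambda>g n. finite_partners \<F> (H n) (g n))"
  define r where "r = (\<lambda>g n. real (card (E g n)) / card (carrier (H n)))"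
  have E: "E g n \<subseteq> carrier (H n)" for g n by (auto simp: E_def finite_partners_def)
  have card_pos: "real (card (carrier (H n))) > 0" for n
    using S.fin[of n] S.H.one_closed[of n] by (auto simp: card_gt_0_iff)
  have r01: "0 \<le> r g n" "r g n \<le> 1" for g n
    using card_mono[OF S.fin E[of g n]] card_pos[of n] by (auto simp: r_def divide_le_eq_1)
  have lim: "(\<lambda>m. \<Prod>n\<le>m. r g n) \<longlonglongrightarrow> measure S.\<mu> (Pi UNIV (E g))" for g
    unfolding r_def by (rule S.measure_\<mu>_box) (rule E)
  have in_class_set: "f g \<in> class_set \<F> tr.G' tr.T' tr.\<mu>' \<longleftrightarrow> measure S.\<mu> (Pi UNIV (E g)) > 0"
    if g: "g \<in> carrier S.G" for g
  proof -
    have fg: "f g \<in> carrier tr.G'" using g by (simp only: tr.carrier_G' imageI)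
    have sub: "Pi UNIV (E g) \<subseteq> carrier S.G" using E by (fastforce simp: S.carrier_G simp del: carrier_product_group)
    have "class_partners \<F> tr.G' tr.T' (f g) = f ` Pi UNIV (E g)"
    proof -
      have "class_partners \<F> tr.G' tr.T' (f g) = f ` {x \<in> carrier S.G. \<forall>n. \<pi> n (f x) \<in> E g n}"
        unfolding sp.class_partners_eq[OF fg] tr.carrier_G' E_def using \<pi>[OF g] by auto
      also have "{x \<in> carrier S.G. \<forall>n. \<pi> n (f x) \<in> E g n} = Pi UNIV (E g)"
      proof (intro equalityI subsetI)
        fix x assume "x \<in> {x \<in> carrier S.G. \<forall>n. \<pi> n (f x) \<in> E g n}"
        then have "x \<in> carrier S.G" "\<And>n. \<pi> n (f x) \<in> E g n" by blast+
        then show "x \<in> Pi UNIV (E g)" using \<pi> by simp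
      next
        fix x assume x: "x \<in> Pi UNIV (E g)"
        then have "x \<in> carrier S.G" using sub by blast
        moreover from this have "\<pi> n (f x) \<in> E g n" for n using \<pi>[of x n] x by auto
        ultimately show "x \<in> {x \<in> carrier S.G. \<forall>n. \<pi> n (f x) \<in> E g n}" by blast
      qed
      finally show ?thesis .
    qed
    then have "emeasure tr.\<mu>' (class_partners \<F> tr.G' tr.T' (f g)) = emeasure S.\<mu> (Pi UNIV (E g))"
      using tr.emeasure_image[OF sub] by simp
    also have "\<dots> = ennreal (measure S.\<mu> (Pi UNIV (E g)))"
      unfolding measure_def S.emeasure_\<mu>[OF sub]
      by (rule S.P.emeasure_eq_measure[unfolded measure_def])
    finally show ?thesis using fg by (simp add: class_set_def)
  qed
  \<comment> \<open>the elements of the class set that converge to \<open>h\<close>\<close>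
  define g where "g = (\<lambda>k n. if n < k then h n else \<one>\<^bsub>H n\<^esub>)"
  have hG: "h \<in> carrier S.G" using gap by (simp add: partner_gap_def PiE_iff)
  have gG: "g k \<in> carrier S.G" for k using gap by (simp add: g_def partner_gap_def PiE_iff)
  have r_h: "r h n > 0" "r h n \<le> \<delta>" for n
  proof -
    have "card (E h n) > 0"
      using gap[of n] finite_subset[OF E S.fin] by (auto simp: E_def partner_gap_def card_gt_0_iff)
    then show "r h n > 0" using card_pos by (simp add: r_def)
    show "r h n \<le> \<delta>" using gap[of n] card_pos[of n] by (simp add: r_def E_def partner_gap_def divide_le_eq)
  qed
  have members: "f (g k) \<in> class_set \<F> tr.G' tr.T' tr.\<mu>'" for k
  proof -
    \<comment> \<open>the factor at \<open>n\<close> is at least \<open>s n\<close> times \<open>1 - 1 / 2 ^ (n + 2)\<close>, uniformly in \<open>n\<close>\<close>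
    define s where "s = (\<lambda>n. if n < k then r h n else 1)"
    have s: "0 \<le> s n" "s n \<le> 1" for n using r01 by (auto simp: s_def)
    have bound: "s n * (1 - 1 / 2 ^ (n + 2)) \<le> r (g k) n" for n
    proof (cases "n < k")
      case True
      then have "r (g k) n = r h n" by (simp add: r_def E_def g_def)
      then show ?thesis using True r01(1)[of h n] by (simp add: s_def mult_left_le)
    next
      case False
      then have "E (g k) n = finite_partners \<F> (H n) \<one>\<^bsub>H n\<^esub>" by (simp add: E_def g_def)
      then show ?thesis
        using False gap[of n] card_pos[of n] by (simp add: s_def r_def partner_gap_def le_divide_eq)
    qed
    define c where "c = (\<Prod>n<k. r h n) / 2"
    have "c > 0" using r_h by (simp add: c_def prod_pos)
    moreover have "c \<le> (\<Prod>n\<le>m. r (g k) n)" if "m \<ge> k" for m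
    proof -
      have "(\<Prod>n\<le>m. s n) = (\<Prod>n<k. s n)"
        using that by (intro prod.mono_neutral_right) (auto simp: s_def)
      also have "\<dots> = (\<Prod>n<k. r h n)" by (simp add: s_def)
      finally have "c \<le> (\<Prod>n\<le>m. s n) * (\<Prod>n\<le>m. 1 - 1 / 2 ^ (n + 2))"
        using prod_one_minus_half_powers[of m] mult_left_mono[of "1/2" "\<Prod>n\<le>m. 1 - 1 / 2 ^ (n + 2)" "\<Prod>n\<le>m. s n"]
          prod_nonneg[of "{..m}" s] s by (simp add: c_def)
      also have "\<dots> = (\<Prod>n\<le>m. s n * (1 - 1 / 2 ^ (n + 2)))" by (simp add: prod.distrib)
      also have "\<dots> \<le> (\<Prod>n\<le>m. r (g k) n)"
      proof (intro prod_mono conjI bound)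
        fix n
        have "(1 :: real) \<le> 2 ^ (n + 2)" by (rule one_le_power) simp
        then have "1 / 2 ^ (n + 2) \<le> (1 :: real)" by simp
        then show "0 \<le> s n * (1 - 1 / 2 ^ (n + 2))" using s(1) by (intro mult_nonneg_nonneg) auto
      qed
      finally show ?thesis .
    qed
    then have "c \<le> measure S.\<mu> (Pi UNIV (E (g k)))"
      by (intro LIMSEQ_le_const[OF lim]) blast
    ultimately show ?thesis using in_class_set[OF gG[of k]] by simp
  qed
  have nonmember: "f h \<notin> class_set \<F> tr.G' tr.T' tr.\<mu>'"
  proof -
    have \<delta>0: "0 \<le> \<delta>" using r_h[of 0] by linarith
    have "(\<Prod>n\<le>m. r h n) \<le> \<delta> ^ Suc m" for m
      using prod_mono[of "{..m}" "r h" "\<lambda>_. \<delta>"] r01 r_h(2) by simp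
    moreover have "(\<lambda>m. \<delta> ^ Suc m) \<longlonglongrightarrow> 0"
      using \<delta> \<delta>0 by (intro LIMSEQ_Suc LIMSEQ_power_zero) simp
    ultimately have "measure S.\<mu> (Pi UNIV (E h)) \<le> 0"
      by (intro LIMSEQ_le[OF lim]) auto
    then show ?thesis using in_class_set[OF hG] by simp
  qed
  have limit: "limitin tr.T' (\<lambda>k. f (g k)) (f h) sequentially"
  proof -
    have "limitin (discrete_topology (carrier (H n))) (\<lambda>k. g k n) (h n) sequentially" for n
    proof (rule limitin_eventually)
      show "h n \<in> topspace (discrete_topology (carrier (H n)))" using gap by (simp add: partner_gap_def)
      show "\<forall>\<^sub>F k in sequentially. g k n = h n"
        using eventually_gt_at_top[of n] by eventually_elim (simp add: g_def)
    qed
    then have "limitin S.T g h sequentially"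
      unfolding S.T_def limitin_componentwise using gG by simp
    from continuous_map_limit[OF homeomorphic_imp_continuous_map[OF tr.homeo] this]
    show ?thesis by (simp add: o_def)
  qed
  have "\<not> closedin tr.T' (class_set \<F> tr.G' tr.T' tr.\<mu>')"
  proof
    assume "closedin tr.T' (class_set \<F> tr.G' tr.T' tr.\<mu>')"
    from limitin_closedin[OF limit this] members nonmember show False by simp
  qed
  then show ?thesis using tr.profinite_G' tr.haar_G' by blast
qed

section \<open>A missing prime: twisted groups\<close>

lemma sum_periodic_shift:
  fixes f :: "nat \<Rightarrow> int"
  assumes "\<And>i. f (i + m) = f i"
  shows "(\<Sum>i<m. f (i + j)) = (\<Sum>i<m. f i)"
proof (induction j)
  case (Suc j)
  have "(\<Sum>i<m. f (i + Suc j)) + f j = (\<Sum>i<Suc m. f (i + j))"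
    by (simp only: sum.lessThan_Suc_shift) simp
  also have "\<dots> = (\<Sum>i<m. f (i + j)) + f j"
    using assms[of j] by (simp add: add.commute)
  finally show ?case using Suc by simp
qed simp

text \<open>The gcd of \<open>s\<close> and \<open>q ^ Suc k\<close> is a smaller power of \<open>q\<close>, hence divides \<open>q ^ k\<close>. In other words,
  every nontrivial subgroup of \<open>\<int>/q\<^sup>k\<^sup>+\<^sup>1\<close> contains \<open>q ^ k\<close>.\<close>

lemma prime_power_multiple_mod:
  fixes s :: int
  assumes q: "Factorial_Ring.prime (q :: nat)" and s: "\<not> int (q ^ Suc k) dvd s"
  obtains j :: nat where "int (q ^ Suc k) dvd int j * s - int (q ^ k)"
proof -
  let ?m = "int (q ^ Suc k)"
  have m0: "?m > 0" using prime_gt_0_nat[OF q] by simp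
  have "nat (gcd s ?m) dvd q ^ Suc k"
    by (metis gcd_dvd2 gcd_ge_0_int int_dvd_int_iff int_nat_eq)
  then obtain i where i: "i \<le> Suc k" "nat (gcd s ?m) = q ^ i"
    using divides_primepow_nat[OF q] by blast
  then have g: "gcd s ?m = int (q ^ i)" by (metis gcd_ge_0_int int_nat_eq)
  have "i \<noteq> Suc k" using g s by (metis gcd_dvd1)
  then have "gcd s ?m dvd int (q ^ k)" using i g by (simp add: le_imp_power_dvd)
  then obtain c where c: "int (q ^ k) = gcd s ?m * c" by (elim dvdE)
  obtain x y where "x * s + y * ?m = gcd s ?m" using bezout_int by blast
  then have "s * (x * c) - int (q ^ k) = ?m * (- y * c)"
    unfolding c by (simp add: algebra_simps flip: distrib_left)
  then have "?m dvd s * (x * c) - int (q ^ k)" by (rule dvdI)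
  moreover have "?m dvd s * (x * c - (x * c) mod ?m)" by simp
  ultimately have "?m dvd (s * (x * c) - int (q ^ k)) - s * (x * c - (x * c) mod ?m)" by (rule dvd_diff)
  then have "?m dvd int (nat ((x * c) mod ?m)) * s - int (q ^ k)"
    using m0 by (simp add: algebra_simps)
  with that show thesis by blast
qed

text \<open>Functions from \<open>\<int>/m\<close> to \<open>\<int>/p\<close>, represented by periodic functions with reduced values. The last
  condition says that the norm of every nontrivial translation kills the function; it makes the
  elements outside the base of the semidirect product below have order dividing \<open>m\<close>.\<close>

definition twisted_functions :: "nat \<Rightarrow> nat \<Rightarrow> (int \<Rightarrow> int) set" where
  "twisted_functions p m = {v. (\<forall>x. v x \<in> {0..<int p}) \<and> (\<forall>x. v (x + int m) = v x) \<and>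
     (\<forall>s x. \<not> int m dvd s \<longrightarrow> int p dvd (\<Sum>i<m. v (x - int i * s)))}"

text \<open>The semidirect product of \<open>twisted_functions p m\<close> and \<open>\<int>/m\<close>, which acts by translation.\<close>

definition twisted_group :: "nat \<Rightarrow> nat \<Rightarrow> ((int \<Rightarrow> int) \<times> int) monoid" where
  "twisted_group p m =
     \<lparr>carrier = twisted_functions p m \<times> {0..<int m},
      mult = (\<lambda>(v, s) (w, t). (\<lambda>x. (v x + w (x - s)) mod int p, (s + t) mod int m)),
      one = (\<lambda>_. 0, 0)\<rparr>"

lemma twisted_functions_mod:
  assumes "v \<in> twisted_functions p m" "int m dvd x - y"
  shows "v x = v y"
proof -
  have per: "v (x + int m) = v x" for x using assms(1) by (simp add: twisted_functions_def)
  have nat: "v (x + int m * int j) = v x" for j x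
  proof (induction j)
    case (Suc j)
    then show ?case using per[of "x + int m * int j"] by (simp add: algebra_simps)
  qed simp
  obtain k where k: "x = y + int m * k" using assms(2) by (metis add.commute diff_add_cancel dvdE)
  show ?thesis
  proof (cases "k \<ge> 0")
    case True
    then show ?thesis using nat[of y "nat k"] k by simp
  next
    case False
    then show ?thesis using nat[of x "nat (- k)"] k by (simp add: algebra_simps)
  qed
qed

lemma twisted_functions_mod_p:
  assumes "v \<in> twisted_functions p m" shows "v x mod int p = v x" "p > 0"
  using assms by (auto simp: twisted_functions_def)

lemma twisted_functionsI:
  assumes "p > 0" "\<And>x. f (x + int m) = f x"
    and "\<And>s x. \<not> int m dvd s \<Longrightarrow> int p dvd (\<Sum>i<m. f (x - int i * s))"
  shows "(\<lambda>x. f x mod int p) \<in> twisted_functions p m"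
  using assms by (auto simp: twisted_functions_def dvd_eq_mod_eq_0 mod_sum_eq)

lemma twisted_functions_add:
  assumes "v \<in> twisted_functions p m" "w \<in> twisted_functions p m"
  shows "(\<lambda>x. (v x + w (x - s)) mod int p) \<in> twisted_functions p m"
proof (rule twisted_functionsI)
  show "p > 0" using twisted_functions_mod_p assms by blast
  have "w (x + int m - s) = w (x - s)" for x by (rule twisted_functions_mod[OF assms(2)]) simp
  then show "v (x + int m) + w (x + int m - s) = v x + w (x - s)" for x
    using assms(1) by (simp add: twisted_functions_def)
  fix t x assume t: "\<not> int m dvd t"
  have "int p dvd (\<Sum>i<m. v (x - int i * t))" "int p dvd (\<Sum>i<m. w ((x - s) - int i * t))"
    using assms t unfolding twisted_functions_def by blast+
  then show "int p dvd (\<Sum>i<m. v (x - int i * t) + w (x - int i * t - s))"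
    by (simp add: sum.distrib algebra_simps)
qed

lemma twisted_functions_zero:
  "p > 0 \<Longrightarrow> (\<lambda>_. 0) \<in> twisted_functions p m"
  by (simp add: twisted_functions_def)

lemma twisted_functions_neg:
  assumes "v \<in> twisted_functions p m"
  shows "(\<lambda>x. (- v (x + s)) mod int p) \<in> twisted_functions p m"
proof (rule twisted_functionsI)
  show "p > 0" using twisted_functions_mod_p assms by blast
  have "v (x + int m + s) = v (x + s)" for x by (rule twisted_functions_mod[OF assms]) simp
  then show "- v (x + int m + s) = - v (x + s)" for x by simp
  fix t x assume t: "\<not> int m dvd t"
  have "int p dvd (\<Sum>i<m. v ((x + s) - int i * t))"
    using assms t unfolding twisted_functions_def by blast
  then show "int p dvd (\<Sum>i<m. - v (x - int i * t + s))"
    by (simp add: sum_negf algebra_simps)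
qed

lemma finite_twisted_functions:
  assumes "m > 0"
  shows "finite (twisted_functions p m)"
proof (rule inj_on_finite)
  show "inj_on (\<lambda>v. restrict v {0..<int m}) (twisted_functions p m)"
  proof (intro inj_onI ext)
    fix v w x assume vw: "v \<in> twisted_functions p m" "w \<in> twisted_functions p m"
      "restrict v {0..<int m} = restrict w {0..<int m}"
    have "v x = v (x mod int m)"
      by (rule twisted_functions_mod[OF vw(1)]) (simp add: mod_eq_dvd_iff[symmetric])
    also have "\<dots> = restrict v {0..<int m} (x mod int m)" using assms by simp
    also have "\<dots> = w (x mod int m)" unfolding vw(3) using assms by simp
    also have "\<dots> = w x"
      by (rule twisted_functions_mod[OF vw(2)]) (simp add: mod_eq_dvd_iff[symmetric])
    finally show "v x = w x" .
  qed
  show "(\<lambda>v. restrict v {0..<int m}) ` twisted_functions p m \<subseteq> ({0..<int m} \<rightarrow>\<^sub>E {0..<int p})"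
    by (auto simp: twisted_functions_def)
  show "finite ({0..<int m} \<rightarrow>\<^sub>E {0..<int p})" by (intro finite_PiE) auto
qed

text \<open>The witness is the difference of the point masses at \<open>0\<close> and \<open>q ^ k\<close>. Summing over the multiples
  of \<open>s\<close>, both contribute equally, because \<open>q ^ k\<close> is itself a multiple of \<open>s\<close> modulo \<open>q ^ Suc k\<close>.\<close>

lemma twisted_functions_nonzero:
  assumes q: "Factorial_Ring.prime (q :: nat)" and p: "p > 1"
  shows "\<exists>v\<in>twisted_functions p (q ^ Suc k). v 0 \<noteq> 0"
proof -
  define m where "m = q ^ Suc k"
  define c where "c = int (q ^ k)"
  define d :: "int \<Rightarrow> int" where "d = (\<lambda>x. if int m dvd x then 1 else 0)"
  have dmod: "d x = d y" if "int m dvd x - y" for x y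
  proof -
    have "x mod int m = y mod int m" using that by (simp add: mod_eq_dvd_iff)
    then show ?thesis by (simp add: d_def dvd_eq_mod_eq_0)
  qed
  have "(\<lambda>x. (d x - d (x - c)) mod int p) \<in> twisted_functions p m"
  proof (rule twisted_functionsI)
    show "p > 0" using p by simp
    show "d (x + int m) - d (x + int m - c) = d x - d (x - c)" for x
      using dmod[of "x + int m" x] dmod[of "x + int m - c" "x - c"] by simp
    fix s x assume "\<not> int m dvd s"
    then obtain j where j: "int m dvd int j * s - c"
      using prime_power_multiple_mod[OF q] unfolding m_def c_def by blast
    define f where "f = (\<lambda>i :: nat. d (x - int i * s))"
    have "d (x - int i * s - c) = f (i + j)" for i
      unfolding f_def using j by (intro dmod) (simp add: algebra_simps)
    moreover have "(\<Sum>i<m. f (i + j)) = (\<Sum>i<m. f i)"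
      by (rule sum_periodic_shift) (simp add: f_def dmod algebra_simps)
    ultimately have "(\<Sum>i<m. d (x - int i * s) - d (x - int i * s - c)) = 0"
      by (simp add: sum_subtractf f_def)
    then show "int p dvd (\<Sum>i<m. d (x - int i * s) - d (x - int i * s - c))" by simp
  qed
  moreover have "\<not> int m dvd - c"
  proof
    assume "int m dvd - c"
    then have "q ^ Suc k dvd q ^ k" by (simp add: m_def c_def flip: of_nat_power of_nat_mult)
    then show False using prime_gt_1_nat[OF q] by (simp add: dvd_power_iff_le)
  qed
  then have "(d 0 - d (0 - c)) mod int p \<noteq> 0" using p by (simp add: d_def)
  ultimately show ?thesis
    unfolding m_def[symmetric] by (intro bexI[of _ "\<lambda>x. (d x - d (x - c)) mod int p"])
qed

locale twisted =
  fixes p m :: nat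
  assumes p: "Factorial_Ring.prime p" and m: "m > 1"
begin

abbreviation "V \<equiv> twisted_functions p m"
abbreviation "K \<equiv> twisted_group p m"

lemma p_pos: "p > 0" using p by (rule prime_gt_0_nat)

lemma carrier_K: "carrier K = V \<times> {0..<int m}"
  by (simp add: twisted_group_def)

lemma mult_K: "(v, s) \<otimes>\<^bsub>K\<^esub> (w, t) = (\<lambda>x. (v x + w (x - s)) mod int p, (s + t) mod int m)"
  by (simp add: twisted_group_def)

lemma one_K: "\<one>\<^bsub>K\<^esub> = (\<lambda>_. 0, 0)"
  by (simp add: twisted_group_def)

lemma group_K: "group K"
proof (rule groupI)
  fix x y assume "x \<in> carrier K" "y \<in> carrier K"
  then show "x \<otimes>\<^bsub>K\<^esub> y \<in> carrier K"
    using m by (cases x; cases y) (auto simp: carrier_K mult_K twisted_functions_add)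
next
  show "\<one>\<^bsub>K\<^esub> \<in> carrier K" using m p_pos by (simp add: carrier_K one_K twisted_functions_zero)
next
  fix x y z assume "x \<in> carrier K" "y \<in> carrier K" "z \<in> carrier K"
  moreover obtain v s w t u r where [simp]: "x = (v, s)" "y = (w, t)" "z = (u, r)"
    by (cases x; cases y; cases z)
  ultimately have u: "u \<in> V" by (simp add: carrier_K)
  have "u (a - (s + t) mod int m) = u (a - s - t)" for a
    by (rule twisted_functions_mod[OF u]) (simp add: algebra_simps minus_mod_eq_mult_div)
  then show "x \<otimes>\<^bsub>K\<^esub> y \<otimes>\<^bsub>K\<^esub> z = x \<otimes>\<^bsub>K\<^esub> (y \<otimes>\<^bsub>K\<^esub> z)"
    by (auto simp: mult_K mod_simps algebra_simps)
next
  fix x assume "x \<in> carrier K"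
  then show "\<one>\<^bsub>K\<^esub> \<otimes>\<^bsub>K\<^esub> x = x"
    by (cases x) (auto simp: carrier_K mult_K one_K twisted_functions_mod_p)
next
  fix x assume x: "x \<in> carrier K"
  obtain v s where [simp]: "x = (v, s)" by (cases x)
  have v: "v \<in> V" and s: "0 \<le> s" "s < int m" using x by (auto simp: carrier_K)
  have "v (a - (- s) mod int m) = v (a + s)" for a
    by (rule twisted_functions_mod[OF v]) (simp add: algebra_simps minus_mod_eq_mult_div)
  then have "(\<lambda>a. (- v (a + s)) mod int p, (- s) mod int m) \<otimes>\<^bsub>K\<^esub> x = \<one>\<^bsub>K\<^esub>"
    by (simp add: mult_K one_K mod_simps)
  moreover have "(\<lambda>a. (- v (a + s)) mod int p, (- s) mod int m) \<in> carrier K"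
    using twisted_functions_neg[OF v] m by (simp add: carrier_K)
  ultimately show "\<exists>y\<in>carrier K. y \<otimes>\<^bsub>K\<^esub> x = \<one>\<^bsub>K\<^esub>" by blast
qed

sublocale group K by (rule group_K)

lemma finite_K: "finite (carrier K)"
  using m finite_twisted_functions[of m p] by (simp add: carrier_K)

lemma pow_K:
  assumes "(v, s) \<in> carrier K"
  shows "(v, s) [^]\<^bsub>K\<^esub> (n :: nat) = (\<lambda>x. (\<Sum>i<n. v (x - int i * s)) mod int p, (int n * s) mod int m)"
proof (induction n)
  case 0
  then show ?case by (simp add: one_K)
next
  case (Suc n)
  have v: "v \<in> V" using assms by (simp add: carrier_K)
  have "v (a - (int n * s) mod int m) = v (a - int n * s)" for a
    by (rule twisted_functions_mod[OF v]) (simp add: algebra_simps minus_mod_eq_mult_div)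
  then show ?case by (simp add: Suc mult_K mod_simps algebra_simps)
qed

lemma pow_m_eq_one:
  assumes "(v, s) \<in> carrier K" "s \<noteq> 0"
  shows "(v, s) [^]\<^bsub>K\<^esub> m = \<one>\<^bsub>K\<^esub>"
proof -
  have "\<not> int m dvd s" using assms by (auto simp: carrier_K zdvd_not_zless)
  then have "int p dvd (\<Sum>i<m. v (x - int i * s))" for x
    using assms(1) by (auto simp: carrier_K twisted_functions_def)
  then show ?thesis using pow_K[OF assms(1)] by (simp add: one_K dvd_eq_mod_eq_0)
qed

lemma ord_base:
  assumes "v \<in> V" "v \<noteq> (\<lambda>_. 0)"
  shows "ord (v, 0) = p"
proof -
  have c: "(v, 0) \<in> carrier K" using assms(1) m by (simp add: carrier_K)
  have "(v, 0) [^]\<^bsub>K\<^esub> p = \<one>\<^bsub>K\<^esub>" using pow_K[OF c] by (simp add: one_K)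
  then have "ord (v, 0) dvd p" using pow_eq_id[OF c] by simp
  moreover have "ord (v, 0) \<noteq> 1" using ord_eq_1[OF c] assms(2) by (simp add: one_K)
  ultimately show ?thesis using p by (auto simp: prime_nat_iff)
qed

definition h :: "(int \<Rightarrow> int) \<times> int" where "h = (\<lambda>_. 0, 1)"

lemma h_carrier: "h \<in> carrier K"
  using m p_pos by (simp add: h_def carrier_K twisted_functions_zero)

text \<open>A power of \<open>h\<close> cancels the translation part \<open>s\<close>.\<close>

lemma base_component_in_generate:
  assumes "(v, s) \<in> carrier K"
  shows "(v, 0) \<in> generate K {(v, s), h}"
proof -
  have s: "0 \<le> s" "s < int m" and v: "v \<in> V" using assms by (auto simp: carrier_K)
  have sub: "subgroup (generate K {(v, s), h}) K"
    using assms h_carrier by (intro generate_is_subgroup) auto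
  have "h \<in> generate K {(v, s), h}" by (auto intro: generate.incl)
  then have "h [^]\<^bsub>K\<^esub> nat (int m - s) \<in> generate K {(v, s), h}"
    using monoid.nat_pow_closed[OF group.is_monoid[OF subgroup_group[OF group_K sub]], of h]
    by (simp flip: nat_pow_consistent)
  then have "(v, s) \<otimes>\<^bsub>K\<^esub> h [^]\<^bsub>K\<^esub> nat (int m - s) \<in> generate K {(v, s), h}"
    by (intro generate.eng) (auto intro: generate.incl)
  moreover have "h [^]\<^bsub>K\<^esub> nat (int m - s) = (\<lambda>_. 0, (int m - s) mod int m)"
    using pow_K[of "\<lambda>_. 0" 1] h_carrier s by (simp add: h_def)
  ultimately show ?thesis
    using v by (simp add: mult_K mod_simps twisted_functions_mod_p)
qed

end

text \<open>Elements with nonzero translation part generate cyclic \<open>q\<close>-groups, so they are partners of the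
  identity. A partner of \<open>h\<close> has trivial function part: otherwise that part would lie in the
  generated group and span a subgroup of order \<open>p\<close>.\<close>

lemma partner_gap_missing_prime:
  assumes form: "group_formation \<F>" and p_prime: "Factorial_Ring.prime p" and missing: "\<not> contains_nontrivial_p_group \<F> p"
    and q: "Factorial_Ring.prime q" "contains_all_cyclic_p_groups \<F> q"
  shows "\<exists>h. partner_gap \<F> (twisted_group p (q ^ Suc k)) h (1 / 2 ^ Suc k) (1 / 2)"
proof -
  define m where "m = q ^ Suc k"
  interpret group_formation \<F> by (rule form)
  have m: "m > 1" unfolding m_def using prime_gt_1_nat[OF q(1)] by (intro one_less_power) auto
  interpret twisted p m using p_prime m by unfold_locales
  have cyc: "in_class \<F> (K\<lparr>carrier := generate K {x}\<rparr>)" if "x \<in> carrier K" "snd x \<noteq> 0" for x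
  proof (rule in_class_cyclic[OF group_K that(1)])
    show "x [^]\<^bsub>K\<^esub> m = \<one>\<^bsub>K\<^esub>" using pow_m_eq_one[of "fst x" "snd x"] that by simp
    show "in_class \<F> (integer_mod_group m)"
      using q(2) unfolding m_def contains_all_cyclic_p_groups_def by blast
  qed (use m in simp)
  have V0: "(\<lambda>_. 0) \<in> V" using twisted_functions_zero p_pos by blast
  obtain v where v: "v \<in> V" "v 0 \<noteq> 0"
    using twisted_functions_nonzero[OF q(1) prime_gt_1_nat[OF p_prime]] unfolding m_def by blast
  have finV: "finite V" using finite_twisted_functions m by simp
  have "card {\<lambda>_. 0, v} \<le> card V" using v V0 finV by (intro card_mono) auto
  moreover have "(\<lambda>_. 0) \<noteq> v" using v(2) by auto
  ultimately have V2: "2 \<le> card V" by simp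
  have cardK: "card (carrier K) = card V * m" unfolding carrier_K by (simp add: card_cartesian_product)
  have "V \<times> {1..<int m} \<subseteq> finite_partners \<F> K \<one>\<^bsub>K\<^esub>"
    using cyc one_in_finite_partners_iff(2)[OF group_K] by (auto simp: carrier_K)
  moreover have "finite (finite_partners \<F> K \<one>\<^bsub>K\<^esub>)"
    by (rule finite_subset[OF _ finite_K]) (auto simp: finite_partners_def)
  ultimately have "card (V \<times> {1..<int m}) \<le> card (finite_partners \<F> K \<one>\<^bsub>K\<^esub>)" by (rule card_mono[rotated])
  then have lower: "card V * (m - 1) \<le> card (finite_partners \<F> K \<one>\<^bsub>K\<^esub>)"
    using m by (simp add: card_cartesian_product nat_diff_distrib)
  have "(2::nat) ^ Suc k \<le> m" unfolding m_def using prime_ge_2_nat[OF q(1)] by (rule power_mono) simp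
  then have "(2::real) ^ Suc k \<le> m" by (metis of_nat_le_iff of_nat_numeral of_nat_power)
  then have "1 - 1 / 2 ^ Suc k \<le> 1 - 1 / real m" by (simp add: frac_le)
  then have "(1 - 1 / 2 ^ Suc k) * real (card (carrier K)) \<le> (1 - 1 / real m) * real (card (carrier K))"
    by (rule mult_right_mono) simp
  also have "\<dots> = real (card V * (m - 1))" using m unfolding cardK by (simp add: field_simps)
  also have "\<dots> \<le> card (finite_partners \<F> K \<one>\<^bsub>K\<^esub>)" using lower by (rule of_nat_mono)
  finally have 1: "(1 - 1 / 2 ^ Suc k) * real (card (carrier K)) \<le> card (finite_partners \<F> K \<one>\<^bsub>K\<^esub>)" .
  have "finite_partners \<F> K h \<subseteq> {\<lambda>_. 0} \<times> {0..<int m}"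
  proof
    fix g assume g: "g \<in> finite_partners \<F> K h"
    obtain w s where [simp]: "g = (w, s)" by (cases g)
    have gK: "(w, s) \<in> carrier K" and cl: "in_class \<F> (K\<lparr>carrier := generate K {(w, s), h}\<rparr>)"
      using g by (auto simp: finite_partners_def)
    have "w = (\<lambda>_. 0)"
    proof (rule ccontr)
      assume "w \<noteq> (\<lambda>_. 0)"
      have wV: "w \<in> V" using gK by (simp add: carrier_K)
      have w0: "(w, 0) \<in> carrier K" using wV m by (simp add: carrier_K)
      let ?S = "generate K {(w, s), h}" and ?C = "generate K {(w, 0)}"
      have S: "subgroup ?S K" using gK h_carrier by (intro generate_is_subgroup) auto
      have C: "subgroup ?C K" using w0 by (intro generate_is_subgroup) auto
      have "?C \<subseteq> ?S" using base_component_in_generate[OF gK] by (intro generate_subgroup_incl[OF _ S]) auto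
      then have "subgroup ?C (K\<lparr>carrier := ?S\<rparr>)" using subgroup_incl[OF C S] by blast
      then have "in_class \<F> (K\<lparr>carrier := ?C\<rparr>)" using in_class_subgroup[OF cl] by fastforce
      then obtain H where H: "H \<in> \<F>" "H \<cong> K\<lparr>carrier := ?C\<rparr>" by (auto simp: in_class_def)
      have "order H = card ?C" using iso_same_card[OF H(2)] by (simp add: order_def)
      also have "\<dots> = p ^ 1" using generate_pow_card[OF w0] ord_base[OF wV \<open>w \<noteq> _\<close>] by simp
      finally have "contains_nontrivial_p_group \<F> p"
        unfolding contains_nontrivial_p_group_def using H(1) zero_less_one by blast
      with missing show False by simp
    qed
    then show "g \<in> {\<lambda>_. 0} \<times> {0..<int m}" using gK by (simp add: carrier_K)
  qed
  then have "card (finite_partners \<F> K h) \<le> card ({\<lambda>_ :: int. 0 :: int} \<times> {0..<int m})"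
    by (rule card_mono[rotated]) simp
  then have "card (finite_partners \<F> K h) \<le> m" by (simp add: card_cartesian_product)
  moreover have "2 * m \<le> card (carrier K)" unfolding cardK using V2 by simp
  ultimately have "2 * card (finite_partners \<F> K h) \<le> card (carrier K)" by linarith
  then have 2: "real (card (finite_partners \<F> K h)) \<le> 1 / 2 * real (card (carrier K))" by linarith
  have "\<one>\<^bsub>K\<^esub> \<in> finite_partners \<F> K h"
    using one_in_finite_partners_iff(1)[OF group_K h_carrier] cyc[OF h_carrier] by (simp add: h_def)
  then have "partner_gap \<F> K h (1 / 2 ^ Suc k) (1 / 2)"
    using group_K finite_K h_carrier 1 2 by (simp add: partner_gap_def)
  then show ?thesis unfolding m_def by blast
qed

section \<open>All primes present: symmetric groups\<close>

definition long_cycle :: "nat \<Rightarrow> nat \<Rightarrow> nat" where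
  "long_cycle n i = (if i \<in> {1..<n} then Suc i else if i = n then 1 else i)"

lemma long_cycle_permutes:
  assumes "n \<ge> 1" shows "long_cycle n permutes {1..n}"
proof (rule bij_imp_permutes)
  have inj: "inj_on (long_cycle n) {1..n}"
    by (auto simp: inj_on_def long_cycle_def split: if_splits)
  moreover have "long_cycle n ` {1..n} \<subseteq> {1..n}"
    using assms by (auto simp: long_cycle_def)
  ultimately have "long_cycle n ` {1..n} = {1..n}"
    by (intro endo_inj_surj) auto
  with inj show "bij_betw (long_cycle n) {1..n} {1..n}" by (simp add: bij_betw_def)
  show "long_cycle n x = x" if "x \<notin> {1..n}" for x
    using that assms by (auto simp: long_cycle_def)
qed

lemma conj_transpose:
  assumes "bij f" shows "f \<circ> Transposition.transpose a b \<circ> Hilbert_Choice.inv f = Transposition.transpose (f a) (f b)"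
proof
  fix y
  obtain x where y: "y = f x" using assms by (metis bij_pointE)
  then show "(f \<circ> Transposition.transpose a b \<circ> Hilbert_Choice.inv f) y = Transposition.transpose (f a) (f b) y"
    using assms by (auto simp: Transposition.transpose_def bij_is_inj inj_eq)
qed

text \<open>Conjugation by the cycle turns \<open>(1 2)\<close> into every adjacent transposition \<open>(i i+1)\<close>. Conjugating
  these in turn gives all \<open>(1 i)\<close>, and then all transpositions.\<close>

lemma sym_group_generated:
  assumes n: "n \<ge> 2"
  shows "generate (sym_group n) {Transposition.transpose 1 2, long_cycle n} = carrier (sym_group n)"
proof -
  let ?G = "sym_group n" and ?t = "Transposition.transpose (1::nat) 2" and ?c = "long_cycle n"
  let ?S = "generate ?G {?t, ?c}"
  interpret group ?G by (rule sym_group_is_group)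
  have c: "?c \<in> carrier ?G" using long_cycle_permutes n by (simp add: sym_group_carrier)
  have t: "?t \<in> carrier ?G" using n by (auto simp: sym_group_carrier intro!: permutes_swap_id)
  have sub: "subgroup ?S ?G" using c t by (intro generate_is_subgroup) auto
  have mult: "x \<circ> y \<in> ?S" if "x \<in> ?S" "y \<in> ?S" for x y
    using subgroup.m_closed[OF sub that] by (simp add: sym_group_mult)
  have cS: "?c \<in> ?S" and tS: "?t \<in> ?S" by (auto intro: generate.incl)
  have inv_cS: "Hilbert_Choice.inv ?c \<in> ?S"
    using subgroup.m_inv_closed[OF sub cS] sym_group_inv_equality[OF c] by simp
  have bij_c: "bij ?c" using permutes_bij[OF long_cycle_permutes[of n]] n by simp
  have adjacent: "Transposition.transpose (Suc i) (Suc (Suc i)) \<in> ?S" if "Suc i < n" for i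
    using that
  proof (induction i)
    case 0
    then show ?case using tS by (simp add: numeral_2_eq_2)
  next
    case (Suc i)
    have "?c \<circ> Transposition.transpose (Suc i) (Suc (Suc i)) \<circ> Hilbert_Choice.inv ?c \<in> ?S"
      using Suc cS inv_cS mult by simp
    moreover have "?c (Suc i) = Suc (Suc i)" "?c (Suc (Suc i)) = Suc (Suc (Suc i))"
      using Suc.prems by (auto simp: long_cycle_def)
    ultimately show ?case unfolding conj_transpose[OF bij_c] by simp
  qed
  have first: "Transposition.transpose 1 (Suc i) \<in> ?S" if "i < n" for i
    using that
  proof (induction i)
    case 0
    have "Transposition.transpose 1 (Suc 0) = \<one>\<^bsub>?G\<^esub>" by (simp add: sym_group_one)
    then show ?case by (simp only: subgroup.one_closed[OF sub])
  next
    case (Suc i)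
    show ?case
    proof (cases "i = 0")
      case True
      then show ?thesis using tS by (simp add: numeral_2_eq_2)
    next
      case False
      let ?f = "Transposition.transpose 1 (Suc i)"
      have "?f \<circ> Transposition.transpose (Suc i) (Suc (Suc i)) \<circ> ?f \<in> ?S"
        using Suc adjacent mult by simp
      moreover have "?f \<circ> Transposition.transpose (Suc i) (Suc (Suc i)) \<circ> ?f = Transposition.transpose 1 (Suc (Suc i))"
        using False by (auto simp: fun_eq_iff Transposition.transpose_def)
      ultimately show ?thesis by simp
    qed
  qed
  have transp: "Transposition.transpose a b \<in> ?S" if ab: "a \<in> {1..n}" "b \<in> {1..n}" "a \<noteq> b" for a b
  proof -
    have a: "Transposition.transpose 1 a \<in> ?S" and b: "Transposition.transpose 1 b \<in> ?S"
      using first[of "a - 1"] first[of "b - 1"] ab by auto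
    consider "a = 1" | "b = 1" | "a \<noteq> 1" "b \<noteq> 1" by blast
    then show ?thesis
    proof cases
      case 2
      then show ?thesis using a by (simp add: transpose_commute)
    next
      case 3
      have "Transposition.transpose 1 a \<circ> Transposition.transpose 1 b \<circ> Transposition.transpose 1 a = Transposition.transpose a b"
        using 3 ab by (auto simp: fun_eq_iff Transposition.transpose_def)
      then show ?thesis using mult[OF mult[OF a b] a] by simp
    qed (use b in simp)
  qed
  have "p \<in> ?S" if "p permutes {1..n}" for p
    using that finite_atLeastAtMost
  proof (induction rule: permutes_induct)
    case id
    then show ?case using subgroup.one_closed[OF sub] unfolding sym_group_one .
  next
    case (swap a b p)
    then show ?case using transp mult by blast
  qed
  then have "carrier ?G \<subseteq> ?S" by (auto simp: sym_group_carrier)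
  then show ?thesis using subgroup.subset[OF sub] by blast
qed

text \<open>Left multiplication permutes the elements of \<open>K\<close>, which \<open>e\<close> numbers from \<open>1\<close>.\<close>

lemma cayley:
  assumes "group K" "finite (carrier K)"
  shows "\<exists>\<phi>. \<phi> \<in> hom K (sym_group (card (carrier K))) \<and> inj_on \<phi> (carrier K)"
proof -
  interpret group K by fact
  define n where "n = card (carrier K)"
  obtain e where e: "bij_betw e {1..n} (carrier K)"
    using ex_bij_betw_nat_finite_1[OF assms(2)] unfolding n_def by blast
  define d where "d = inv_into {1..n} e"
  have d: "bij_betw d (carrier K) {1..n}" unfolding d_def using e by (rule bij_betw_inv_into)
  have ed: "e (d x) = x" "d x \<in> {1..n}" if "x \<in> carrier K" for x
    using bij_betw_inv_into_right[OF e that] bij_betwE[OF d] that unfolding d_def by blast+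
  have de: "d (e i) = i" "e i \<in> carrier K" if "i \<in> {1..n}" for i
    using bij_betw_inv_into_left[OF e that] bij_betwE[OF e] that unfolding d_def by blast+
  define \<phi> where "\<phi> = (\<lambda>k i. if i \<in> {1..n} then d (k \<otimes>\<^bsub>K\<^esub> e i) else i)"
  have "\<phi> k permutes {1..n}" if k: "k \<in> carrier K" for k
  proof (rule bij_imp_permutes)
    have "bij_betw (\<lambda>x. k \<otimes>\<^bsub>K\<^esub> x) (carrier K) (carrier K)"
      using inj_on_cmult[OF k] surj_const_mult[OF k] by (simp add: bij_betw_def)
    then have "bij_betw (d \<circ> ((\<lambda>x. k \<otimes>\<^bsub>K\<^esub> x) \<circ> e)) {1..n} {1..n}"
      using bij_betw_trans[OF bij_betw_trans[OF e] d] by blast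
    then show "bij_betw (\<phi> k) {1..n} {1..n}"
      by (rule bij_betw_cong[THEN iffD1, rotated]) (simp add: \<phi>_def)
  qed (auto simp: \<phi>_def)
  moreover have "\<phi> (k \<otimes>\<^bsub>K\<^esub> l) = \<phi> k \<circ> \<phi> l" if "k \<in> carrier K" "l \<in> carrier K" for k l
  proof
    fix i
    show "\<phi> (k \<otimes>\<^bsub>K\<^esub> l) i = (\<phi> k \<circ> \<phi> l) i"
      using that de[of i] ed[of "l \<otimes>\<^bsub>K\<^esub> e i"] by (auto simp: \<phi>_def m_assoc)
  qed
  ultimately have "\<phi> \<in> hom K (sym_group n)"
    by (auto simp: hom_def sym_group_carrier sym_group_mult)
  moreover have "inj_on \<phi> (carrier K)"
  proof (rule inj_onI)
    fix k l assume kl: "k \<in> carrier K" "l \<in> carrier K" "\<phi> k = \<phi> l"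
    have "\<phi> k (d \<one>\<^bsub>K\<^esub>) = d k" "\<phi> l (d \<one>\<^bsub>K\<^esub>) = d l"
      using kl(1,2) ed[of "\<one>\<^bsub>K\<^esub>"] by (auto simp: \<phi>_def)
    then have "e (d k) = e (d l)" using kl(3) by simp
    then show "k = l" using ed kl by simp
  qed
  ultimately show ?thesis unfolding n_def by blast
qed

text \<open>By Cayley's theorem the symmetric group is not in the class either. Of its two generators, the
  transposition is therefore not a partner of the cycle, which keeps the proportion of partners
  below \<open>1\<close>. Every element is a partner of the identity since all cyclic groups are in the class.\<close>

lemma partner_gap_cyclic_closed:
  fixes K :: "'k monoid"
  assumes form: "group_formation \<F>"
    and cyc: "\<And>p. Factorial_Ring.prime p \<Longrightarrow> contains_all_cyclic_p_groups \<F> p"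
    and K: "group K" "finite (carrier K)" "\<not> in_class \<F> K" and \<epsilon>: "\<epsilon> \<ge> 0"
  shows "\<exists>h. partner_gap \<F> (sym_group (card (carrier K))) h \<epsilon>
     (1 - 1 / card (carrier (sym_group (card (carrier K)))))"
proof -
  define n where "n = card (carrier K)"
  let ?S = "sym_group n"
  interpret group_formation \<F> by (rule form)
  interpret S: group ?S by (rule sym_group_is_group)
  have "n \<noteq> 0"
    unfolding n_def using K(2) monoid.one_closed[OF group.is_monoid[OF K(1)]] by auto
  moreover have "n \<noteq> 1"
  proof
    assume "n = 1"
    then obtain x where "carrier K = {x}" unfolding n_def using card_1_singletonE by blast
    then have "carrier K = {\<one>\<^bsub>K\<^esub>}" using monoid.one_closed[OF group.is_monoid[OF K(1)]] by auto
    then show False using in_class_trivial[OF K(1)] K(3) by blast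
  qed
  ultimately have n: "n \<ge> 2" by linarith
  have fin: "finite (carrier ?S)"
    by (rule card_ge_0_finite) (simp add: sym_group_card_carrier)
  have notS: "\<not> in_class \<F> ?S"
    using cayley[OF K(1,2)] in_class_embed K(1,3) unfolding n_def by blast
  let ?t = "Transposition.transpose (1::nat) 2" and ?c = "long_cycle n"
  have c: "?c \<in> carrier ?S" using long_cycle_permutes n by (simp add: sym_group_carrier)
  have t: "?t \<in> carrier ?S" using n by (auto simp: sym_group_carrier intro!: permutes_swap_id)
  have cyc': "in_class \<F> (?S\<lparr>carrier := generate ?S {x}\<rparr>)" if x: "x \<in> carrier ?S" for x
  proof (rule in_class_cyclic[OF S.is_group x S.pow_order_eq_1[OF x]])
    show "order ?S > 0" using fin by (simp add: S.order_gt_0_iff_finite)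
    then show "in_class \<F> (integer_mod_group (order ?S))" using in_class_all_cyclic cyc by blast
  qed
  have "?t \<notin> finite_partners \<F> ?S ?c"
    using notS sym_group_generated[OF n] by (auto simp: finite_partners_def)
  then have "finite_partners \<F> ?S ?c \<subseteq> carrier ?S - {?t}" by (auto simp: finite_partners_def)
  then have "card (finite_partners \<F> ?S ?c) \<le> card (carrier ?S - {?t})"
    using fin by (intro card_mono) auto
  also have "\<dots> = card (carrier ?S) - 1" using t fin by simp
  finally have "real (card (finite_partners \<F> ?S ?c)) \<le> real (card (carrier ?S) - 1)" by (rule of_nat_mono)
  moreover have pos: "card (carrier ?S) > 0" using fin t by (auto simp: card_gt_0_iff)
  ultimately have 1: "real (card (finite_partners \<F> ?S ?c)) \<le> (1 - 1 / card (carrier ?S)) * real (card (carrier ?S))"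
    by (simp add: left_diff_distrib of_nat_diff)
  have "finite_partners \<F> ?S \<one>\<^bsub>?S\<^esub> = carrier ?S"
    using one_in_finite_partners_iff(2)[OF S.is_group] cyc' by (auto simp: finite_partners_def)
  then have 2: "(1 - \<epsilon>) * real (card (carrier ?S)) \<le> card (finite_partners \<F> ?S \<one>\<^bsub>?S\<^esub>)"
    using mult_right_mono[of "1 - \<epsilon>" 1 "real (card (carrier ?S))"] \<epsilon> by simp
  have "\<one>\<^bsub>?S\<^esub> \<in> finite_partners \<F> ?S ?c"
    using one_in_finite_partners_iff(1)[OF S.is_group c] cyc'[OF c] by simp
  then have "partner_gap \<F> ?S ?c \<epsilon> (1 - 1 / card (carrier ?S))"
    using S.is_group fin c 1 2 by (simp add: partner_gap_def)
  then show ?thesis unfolding n_def by blast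
qed

section \<open>The equivalence\<close>

text \<open>A Sylow subgroup of a nontrivial member is in the class.\<close>

lemma (in group_formation) contains_some_prime:
  assumes "\<exists>H\<in>\<F>. carrier H \<noteq> {\<one>\<^bsub>H\<^esub>}"
  shows "\<exists>q. Factorial_Ring.prime q \<and> contains_nontrivial_p_group \<F> q"
proof -
  obtain H where H: "H \<in> \<F>" "carrier H \<noteq> {\<one>\<^bsub>H\<^esub>}" using assms by blast
  have HK: "group H" "finite (carrier H)" using in_classD[OF in_class_member[OF H(1)]] by auto
  interpret group H by (rule HK)
  have "order H \<noteq> 1"
  proof
    assume "order H = 1"
    then obtain x where "carrier H = {x}" unfolding order_def using card_1_singletonE by blast
    then show False using H(2) one_closed by auto
  qed
  then obtain q where q: "Factorial_Ring.prime q" "q dvd order H" using prime_factor_nat by blast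
  define k where "k = multiplicity q (order H)"
  have pos: "order H > 0" using HK(2) order_gt_0_iff_finite by blast
  then have k: "k > 0" unfolding k_def using q by (simp add: prime_multiplicity_gt_zero_iff)
  obtain r where "order H = q ^ k * r"
    using multiplicity_dvd[of q "order H"] unfolding k_def by (elim dvdE)
  then obtain S where S: "subgroup S H" "card S = q ^ k"
    using sylow_thm[OF q(1) HK(1) _ HK(2)] by blast
  then have "in_class \<F> (H\<lparr>carrier := S\<rparr>)" using in_class_subgroup[OF in_class_member[OF H(1)]] by blast
  then obtain H' where H': "H' \<in> \<F>" "H' \<cong> H\<lparr>carrier := S\<rparr>" by (auto simp: in_class_def)
  have "order H' = q ^ k" using iso_same_card[OF H'(2)] S(2) by (simp add: order_def)
  then show ?thesis using H'(1) k q(1) unfolding contains_nontrivial_p_group_def by blast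
qed

lemma class_set_all_finite_groups_closed:
  assumes "profinite_group G T" "normalized_haar_measure G T \<mu>"
  shows "closedin T (class_set all_finite_groups G T \<mu>)"
proof -
  have "class_set all_finite_groups G T \<mu> = topspace T"
    using assms class_partners_all_finite_groups[OF assms(1)] profinite_groupD(2)[OF assms(1)]
    by (auto simp: class_set_def normalized_haar_measure_def)
  then show ?thesis by simp
qed

lemma exists_class_set_not_closed:
  assumes form: "group_formation \<F>" and nontriv: "\<exists>H\<in>\<F>. carrier H \<noteq> {\<one>\<^bsub>H\<^esub>}"
    and pp: "\<And>p::nat. Factorial_Ring.prime p \<Longrightarrow> contains_nontrivial_p_group \<F> p \<Longrightarrow>
           contains_all_cyclic_p_groups \<F> p"
    and large: "(UNIV :: nat set set) \<lesssim> (UNIV :: 'a set)"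
    and proper: "\<F> \<noteq> all_finite_groups"
  shows "\<exists>(G :: 'a monoid) T \<mu>. profinite_group G T \<and> normalized_haar_measure G T \<mu> \<and>
    \<not> closedin T (class_set \<F> G T \<mu>)"
proof (cases "\<forall>p. Factorial_Ring.prime p \<longrightarrow> contains_nontrivial_p_group \<F> p")
  case True
  interpret group_formation \<F> by (rule form)
  have "\<F> \<subseteq> all_finite_groups"
    using isomorphic_closed by (auto simp: finite_group_class_def all_finite_groups_def)
  with proper obtain K where K: "K \<in> all_finite_groups" "K \<notin> \<F>" by blast
  then have grp: "group K" "finite (carrier K)" by (auto simp: all_finite_groups_def)
  have "\<not> in_class \<F> K"
  proof
    assume "in_class \<F> K"
    then obtain H where "H \<in> \<F>" "H \<cong> K" by (auto simp: in_class_def)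
    then have "K \<in> \<F>" using isomorphic_closed grp(1) unfolding finite_group_class_def by blast
    with K(2) show False by blast
  qed
  then have gap: "\<exists>h. partner_gap \<F> (sym_group (card (carrier K))) h (1 / 2 ^ (n + 2))
     (1 - 1 / card (carrier (sym_group (card (carrier K)))))" for n
    using True pp by (intro partner_gap_cyclic_closed form grp) auto
  have "\<exists>(K' :: real monoid) h. partner_gap \<F> K' h (1 / 2 ^ (n + 2))
     (1 - 1 / card (carrier (sym_group (card (carrier K)))))" for n
    using gap[of n] by (elim exE) (rule partner_gap_copy[OF form _ infinite_UNIV_char_0])
  moreover have "card (carrier (sym_group (card (carrier K)))) > 0"
    by (simp add: sym_group_card_carrier)
  ultimately show ?thesis by (intro class_set_not_closed[OF form _ _ large]) auto
next
  case False
  then obtain p where p: "Factorial_Ring.prime p" "\<not> contains_nontrivial_p_group \<F> p" by blast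
  obtain q where q: "Factorial_Ring.prime q" "contains_nontrivial_p_group \<F> q"
    using group_formation.contains_some_prime[OF form nontriv] by blast
  have gap: "\<exists>h. partner_gap \<F> (twisted_group p (q ^ Suc (Suc n))) h (1 / 2 ^ (n + 2)) (1 / 2)" for n
    using partner_gap_missing_prime[OF form p q(1) pp[OF q], of "Suc n"] by simp
  have "\<exists>(K' :: real monoid) h. partner_gap \<F> K' h (1 / 2 ^ (n + 2)) (1 / 2)" for n
    using gap[of n] by (elim exE) (rule partner_gap_copy[OF form _ infinite_UNIV_char_0])
  then show ?thesis by (intro class_set_not_closed[OF form _ _ large]) auto
qed

theorem theorem4:
  fixes \<F> :: "nat monoid set"
  assumes "finite_group_class \<F>"
    and "subgroup_closed \<F>"
    and "quotient_closed \<F>"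
    and "product_closed \<F>"
    and "\<exists>H\<in>\<F>. carrier H \<noteq> {\<one>\<^bsub>H\<^esub>}"
    and "\<And>p::nat. Factorial_Ring.prime p \<Longrightarrow> contains_nontrivial_p_group \<F> p \<Longrightarrow>
           contains_all_cyclic_p_groups \<F> p"
    and "(UNIV :: nat set set) \<lesssim> (UNIV :: 'a set)"
  shows "(\<forall>(G :: 'a monoid) T \<mu>. profinite_group G T \<longrightarrow> normalized_haar_measure G T \<mu> \<longrightarrow>
            closedin T (class_set \<F> G T \<mu>))
         \<longleftrightarrow> \<F> = all_finite_groups"
proof
  assume closed: "\<forall>(G :: 'a monoid) T \<mu>. profinite_group G T \<longrightarrow> normalized_haar_measure G T \<mu> \<longrightarrow>
            closedin T (class_set \<F> G T \<mu>)"
  have "group_formation \<F>"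
    using assms(1-5) by (intro group_formation.intro) auto
  from exists_class_set_not_closed[OF this assms(5-7)] closed
  show "\<F> = all_finite_groups" by blast
next
  assume "\<F> = all_finite_groups"
  then show "\<forall>(G :: 'a monoid) T \<mu>. profinite_group G T \<longrightarrow> normalized_haar_measure G T \<mu> \<longrightarrow>
            closedin T (class_set \<F> G T \<mu>)"
    using class_set_all_finite_groups_closed by blast
qed

end
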